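(* Let $P\subset\mathbb{R}^d$ be a simple $d$-dimensional polytope in $3$-general linear position and containing the origin in its interior. Then the combinatorial type of $P$ is reconstructible from the function $\varphi_P:\mathbb{S}^{d-1}\to\mathbb{N}$, $\varphi_P(u)=f_0(P\cap u^\perp)$. That is, if $P,Q\subset\mathbb{R}^d$ are two simple $d$-dimensional polytopes in $3$-general linear position, both containing the origin in their interiors, and $\varphi_P=\varphi_Q$, then $P$ and $Q$ are combinatorially equivalent.
   Context: $f_0$ denotes the number of vertices, and $u^\perp$ is the hyperplane through the origin orthogonal to $u$. A polytope is in $3$-general linear position if every $3$-element subset of its vertex set is linearly independent. A $d$-polytope is simple if every vertex lies on exactly $d$ edges. Two polytopes are combinatorially equivalent if their face lattices are isomorphic. *)

theory Defs
  imports "HOL-Analysis.Analysis"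
begin

definition vertices :: "'a::euclidean_space set \<Rightarrow> 'a set"
  where "vertices P = {v. v extreme_point_of P}"

(* f_0 *)
definition num_vertices :: "'a::euclidean_space set \<Rightarrow> nat"
  where "num_vertices P = card (vertices P)"

(* aff_dim is int-valued, hence the coercion. *)
definition simple_polytope :: "'a::euclidean_space set \<Rightarrow> bool"
  where "simple_polytope P \<longleftrightarrow> polytope P \<and>
    (\<forall>v \<in> vertices P. int (card {e. e edge_of P \<and> v \<in> e}) = aff_dim P)"

definition three_general_linear_position :: "'a::euclidean_space set \<Rightarrow> bool"
  where "three_general_linear_position P \<longleftrightarrow>
    (\<forall>T. T \<subseteq> vertices P \<and> card T = 3 \<longrightarrow> independent T)"

(* Isomorphism of the face lattices, ordered by inclusion. The relation face_of
   includes both improper faces, the empty face and the polytope itself. *)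
definition combinatorially_equivalent ::
    "'a::euclidean_space set \<Rightarrow> 'b::euclidean_space set \<Rightarrow> bool"
  where "combinatorially_equivalent P Q \<longleftrightarrow>
    (\<exists>f. bij_betw f {F. F face_of P} {G. G face_of Q} \<and>
      (\<forall>F F'. F face_of P \<and> F' face_of P \<longrightarrow> (F \<subseteq> F' \<longleftrightarrow> f F \<subseteq> f F')))"

(* Only the values on the unit sphere are meaningful: there, the orthogonal
   complement of {u} is a hyperplane through the origin. *)
definition section_vertex_count :: "'a::euclidean_space set \<Rightarrow> 'a \<Rightarrow> nat"
  where "section_vertex_count P u = num_vertices (P \<inter> {u}\<^sup>\<bottom>)"

end

(* For a polytope P and u <> 0, the vertices of P \<inter> u\<^sup>\<bottom> are the vertices of P in u\<^sup>\<bottom> together with one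
   point for each edge crossing u\<^sup>\<bottom>. If u is generic in v\<^sup>\<bottom> for a vertex v of degree d, then the
   second difference of the count across v\<^sup>\<bottom> at u is d - 2, so for d >= 3 the count determines the
   lines spanned by the vertices. If u is generic in v\<^sup>\<bottom> \<inter> w\<^sup>\<bottom>, the mixed second difference detects
   whether vw is an edge. Hence the vertices of Q are multiples of those of P, with the same edges and
   with multipliers of equal sign at the two ends of an edge.

   Instead of appealing to the theorem that a simple polytope is determined by its graph, facets are
   matched geometrically. A facet F of P through a vertex v omits exactly one neighbour of v; let G be the
   facet of Q through the vertex corresponding to v that omits the corresponding neighbour. Two
   different neighbours x, y of w are strictly separated by the hyperplane through 0, w and the
   remaining neighbours of w; this forces F and G to omit the same neighbour at every vertex reached
   along edges of F. For d = 2 general position is impossible, and for d = 1 all polytopes are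
   segments. *)

theory Submission
  imports Defs
begin

section \<open>Vertices, edges and hyperplane sections\<close>

text \<open>The inequality rules out the degenerate segment from a vertex to itself, which is a face
  as well.\<close>

definition adjacent :: "'a::euclidean_space set \<Rightarrow> 'a \<Rightarrow> 'a \<Rightarrow> bool"
  where "adjacent P v w \<longleftrightarrow> v \<noteq> w \<and> closed_segment v w face_of P"

definition neighbours :: "'a::euclidean_space set \<Rightarrow> 'a \<Rightarrow> 'a set"
  where "neighbours P v = {w. adjacent P v w}"

lemma adjacent_commute: "adjacent P v w \<longleftrightarrow> adjacent P w v"
  by (auto simp: adjacent_def closed_segment_commute)

lemma adjacent_vertices:
  assumes "adjacent P v w"
  shows "v \<in> vertices P" "w \<in> vertices P"
  using assms extreme_point_of_face[of "closed_segment v w" P]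
  by (auto simp: adjacent_def vertices_def extreme_point_of_segment)

lemma vertices_face: "F face_of P \<Longrightarrow> vertices F = vertices P \<inter> F"
  by (auto simp: vertices_def extreme_point_of_face)

lemma vertices_subset: "vertices P \<subseteq> P"
  by (auto simp: vertices_def extreme_point_of_def)

lemma adjacent_face:
  assumes "F face_of P"
  shows "adjacent F v w \<longleftrightarrow> adjacent P v w \<and> v \<in> F \<and> w \<in> F"
  using assms face_of_imp_convex[OF assms]
  by (auto simp: adjacent_def face_of_face dest: subsetD[OF closed_segment_subset])

lemma neighbours_face:
  assumes "F face_of P" "v \<in> F"
  shows "neighbours F v = neighbours P v \<inter> F"
  using assms by (auto simp: neighbours_def adjacent_face)

lemma neighbours_subset_vertices: "neighbours P v \<subseteq> vertices P"
  by (auto simp: neighbours_def adjacent_vertices)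

lemma finite_vertices: "polytope P \<Longrightarrow> finite (vertices P)"
  unfolding vertices_def by (rule finite_polyhedron_extreme_points[OF polytope_imp_polyhedron])

lemma finite_neighbours: "polytope P \<Longrightarrow> finite (neighbours P v)"
  by (meson finite_subset finite_vertices neighbours_subset_vertices)

lemma polytope_eq_hull_vertices: "polytope P \<Longrightarrow> P = convex hull (vertices P)"
  unfolding vertices_def
  by (rule Krein_Milman_Minkowski[OF polytope_imp_compact polytope_imp_convex])

lemma one_dim_polytope_segment:
  assumes "polytope F" "aff_dim F = 1"
  obtains a b where "a \<noteq> b" "F = closed_segment a b"
proof -
  have "F \<noteq> {}" using assms by auto
  moreover have "collinear F" using assms by (simp add: collinear_aff_dim)
  ultimately obtain a b where ab: "F = closed_segment a b"
    using compact_convex_collinear_segment assms polytope_imp_compact polytope_imp_convex by metis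
  have "a \<noteq> b" using assms(2) unfolding ab by auto
  then show ?thesis using ab that by blast
qed

lemma aff_dim_closed_segment: "a \<noteq> b \<Longrightarrow> aff_dim (closed_segment a b) = 1"
  by (simp add: segment_convex_hull aff_dim_convex_hull aff_dim_2)

text \<open>Translates the edge count in \<open>simple_polytope\<close> into a degree in the graph.
  A one-dimensional face is a segment, and a vertex of \<open>P\<close> lying in it is extreme in
  it, hence one of its ends.\<close>

lemma edges_at_vertex:
  assumes "polytope P" "v \<in> vertices P"
  shows "bij_betw (closed_segment v) (neighbours P v) {e. e edge_of P \<and> v \<in> e}"
  unfolding bij_betw_def
proof (intro conjI set_eqI iffI)
  show "inj_on (closed_segment v) (neighbours P v)"
    by (auto simp: inj_on_def closed_segment_eq doubleton_eq_iff neighbours_def adjacent_def)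
  fix e
  show "e \<in> {e. e edge_of P \<and> v \<in> e}" if "e \<in> closed_segment v ` neighbours P v"
    using that by (auto simp: edge_of_def neighbours_def adjacent_def aff_dim_closed_segment)
  assume "e \<in> {e. e edge_of P \<and> v \<in> e}"
  then have e: "e face_of P" "aff_dim e = 1" "v \<in> e" by (auto simp: edge_of_def)
  then obtain a b where ab: "a \<noteq> b" "e = closed_segment a b"
    using one_dim_polytope_segment face_of_polytope_polytope[OF assms(1)] by metis
  have "v extreme_point_of e"
    using assms e extreme_point_of_face[OF e(1)] by (simp add: vertices_def)
  then have "v = a \<or> v = b" by (simp add: ab extreme_point_of_segment)
  then obtain w where "v \<noteq> w" "e = closed_segment v w"
    using ab by (metis closed_segment_commute)
  then show "e \<in> closed_segment v ` neighbours P v"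
    using e by (auto simp: neighbours_def adjacent_def)
qed

lemma card_neighbours_simple:
  assumes "simple_polytope P" "v \<in> vertices P"
  shows "int (card (neighbours P v)) = aff_dim P"
  using assms bij_betw_same_card[OF edges_at_vertex] unfolding simple_polytope_def by metis

section \<open>Extreme points of sections and local optimality at a vertex\<close>

text \<open>A face of least dimension containing \<open>z\<close> works: if \<open>z\<close> were on
  its relative frontier, a proper face of smaller dimension would contain \<open>z\<close>.\<close>

lemma face_with_point_in_rel_interior:
  fixes z :: "'a::euclidean_space"
  assumes "polytope P" "z \<in> P"
  obtains F where "F face_of P" "z \<in> rel_interior F"
proof -
  let ?\<F> = "{F. F face_of P \<and> z \<in> F}"
  have "P \<in> ?\<F>" using assms by (auto simp: face_of_refl polytope_imp_convex)
  \<comment> \<open>\<open>aff_dim\<close> is -1 on the empty set, so it is shifted by one before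
    the passage to \<open>nat\<close>.\<close>
  then obtain F where F: "F \<in> ?\<F>" and min: "\<And>G. G \<in> ?\<F> \<Longrightarrow> nat (aff_dim F + 1) \<le> nat (aff_dim G + 1)"
    using ex_has_least_nat[of "\<lambda>F. F \<in> ?\<F>" P "\<lambda>F. nat (aff_dim F + 1)"] by blast
  have pF: "polytope F" using F assms face_of_polytope_polytope by blast
  have "z \<in> rel_interior F"
  proof (rule ccontr)
    assume "z \<notin> rel_interior F"
    then have "z \<in> rel_frontier F"
      using F pF by (simp add: rel_frontier_def polytope_imp_closed)
    then obtain G where G: "G face_of F" "G \<noteq> F" "z \<in> G"
      using rel_frontier_of_polyhedron_alt[OF polytope_imp_polyhedron[OF pF]] by auto
    then have "aff_dim G < aff_dim F" using face_of_aff_dim_lt pF polytope_imp_convex by blast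
    moreover have "G \<in> ?\<F>" using G F face_of_trans by blast
    ultimately show False using min[of G] G aff_dim_geq[of G] by fastforce
  qed
  then show ?thesis using F that by blast
qed

text \<open>Let \<open>F\<close> be the face with \<open>z\<close> in its relative interior. The
  affine hull of \<open>F\<close> meets the hyperplane only in \<open>z\<close>, since otherwise
  \<open>z\<close> could be moved both ways inside the section. So \<open>F\<close> has dimension at
  most 1, and as \<open>z\<close> is no vertex it is an edge, whose ends lie strictly on opposite
  sides.\<close>

lemma extreme_point_of_section:
  fixes P :: "'a::euclidean_space set"
  assumes P: "polytope P" and z: "z extreme_point_of (P \<inter> {x. b \<bullet> x = c})"
    and "z \<notin> vertices P"
  obtains v w where "adjacent P v w" "b \<bullet> v < c" "c < b \<bullet> w" "z \<in> open_segment v w"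
proof -
  have zP: "z \<in> P" "b \<bullet> z = c" using z by (auto simp: extreme_point_of_def)
  obtain F where F: "F face_of P" "z \<in> rel_interior F"
    using face_with_point_in_rel_interior P zP by metis
  have zF: "z \<in> F" using F rel_interior_subset by blast
  have pF: "polytope F" using F face_of_polytope_polytope P by blast
  have FP: "F \<subseteq> P" using F face_of_imp_subset by blast
  have no_line: "y = z" if y: "y \<in> affine hull F" "b \<bullet> y = c" for y
  proof (rule ccontr)
    assume yz: "y \<noteq> z"
    obtain e where e: "e > 0" "cball z e \<inter> affine hull F \<subseteq> F"
      using F by (auto simp: mem_rel_interior_cball)
    \<comment> \<open>The length \<open>e\<close> keeps both \<open>z + d\<close> and
      \<open>z - d\<close> in the ball around \<open>z\<close> whose part in the affine hull lies in
      \<open>F\<close>.\<close>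
    define d where "d = (e / norm (y - z)) *\<^sub>R (y - z)"
    have nd: "norm d = e" using yz e by (simp add: d_def)
    have zaff: "z \<in> affine hull F" using zF hull_inc by metis
    have mem: "z + t *\<^sub>R d \<in> F \<inter> {x. b \<bullet> x = c}" if "\<bar>t\<bar> \<le> 1" for t
    proof -
      have "z + (t * (e / norm (y - z))) *\<^sub>R (y - z) \<in> affine hull F"
        using mem_affine_3_minus[OF affine_affine_hull zaff y(1) zaff] by simp
      moreover have "z + t *\<^sub>R d \<in> cball z e" using that nd e by (simp add: dist_norm mult_left_le_one_le)
      ultimately have "z + t *\<^sub>R d \<in> F" using e by (auto simp: d_def)
      moreover have "b \<bullet> (z + t *\<^sub>R d) = c"
        using y(2) zP(2) by (simp add: d_def inner_add_right inner_diff_right)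
      ultimately show ?thesis by simp
    qed
    have "d \<noteq> 0" using nd e by auto
    then have "z \<in> open_segment (z + 1 *\<^sub>R d) (z + (-1) *\<^sub>R d)"
      unfolding in_segment
      by (auto simp: algebra_simps eq_neg_iff_add_eq_0 scaleR_2[symmetric] intro!: exI[of _ "1/2"])
    then show False using z mem[of 1] mem[of "-1"] FP unfolding extreme_point_of_def by fastforce
  qed
  have "affine hull F \<inter> {x. b \<bullet> x = c} = {z}"
    using no_line zP zF hull_inc[of z F] by auto
  \<comment> \<open>An affine set meeting a hyperplane loses at most one dimension, so a single
    common point leaves only 0 or 1 for \<open>F\<close>.\<close>
  then have "aff_dim (affine hull F \<inter> {x. b \<bullet> x = c}) = 0" by simp
  moreover have "affine hull F \<inter> {x. b \<bullet> x = c} \<noteq> {}" using zF zP hull_inc[of z F] by auto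
  ultimately have dim: "aff_dim F = 0 \<or> aff_dim F = 1"
    by (auto simp: aff_dim_affine_Int_hyperplane split: if_splits)
  have "aff_dim F \<noteq> 0"
  proof
    assume "aff_dim F = 0"
    then have "F = {z}" using zF aff_dim_eq_0[of F] by auto
    then have "z \<in> vertices P" using F by (simp add: vertices_def face_of_singleton)
    then show False using assms by simp
  qed
  then obtain v w where vw: "v \<noteq> w" "F = closed_segment v w"
    using one_dim_polytope_segment[OF pF] dim by auto
  have adj: "adjacent P v w" using vw F by (simp add: adjacent_def)
  have "z \<noteq> v" "z \<noteq> w" using adjacent_vertices[OF adj] assms by auto
  then have zo: "z \<in> open_segment v w" using zF vw by (simp add: open_segment_def)
  then obtain t where t: "0 < t" "t < 1" "z = (1 - t) *\<^sub>R v + t *\<^sub>R w" by (auto simp: in_segment)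
  have bz: "c = (1 - t) * (b \<bullet> v) + t * (b \<bullet> w)" using zP t by (simp add: inner_add_right)
  have "b \<bullet> v \<noteq> c" using no_line[of v] vw \<open>z \<noteq> v\<close> by (metis ends_in_segment(1) hull_inc)
  moreover have "t * (b \<bullet> w - c) = (1 - t) * (c - b \<bullet> v)" using bz by (simp add: algebra_simps)
  then have "b \<bullet> v < c \<Longrightarrow> c < b \<bullet> w" "c < b \<bullet> v \<Longrightarrow> b \<bullet> w < c"
    using t by (smt (verit) mult_pos_pos mult_pos_neg mult_nonneg_nonpos mult_nonneg_nonneg)+
  ultimately show ?thesis
    using that[OF adj] that[of w v] adj adjacent_commute zo open_segment_commute
    by (metis linorder_neqE_linordered_idom)
qed

text \<open>Local minimality in the graph is global. A hyperplane cutting off \<open>v\<close> alone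
  meets \<open>P\<close> in a section whose extreme points lie on edges at \<open>v\<close>, so
  \<open>a\<close> is at least \<open>a \<bullet> v\<close> on the whole section. The segment from
  \<open>v\<close> to \<open>x\<close> crosses the section, and linearity carries the bound on to
  \<open>x\<close>.\<close>

lemma vertex_minimum_of_neighbours:
  fixes P :: "'a::euclidean_space set"
  assumes P: "polytope P" and v: "v \<in> vertices P"
    and a: "\<And>w. w \<in> neighbours P v \<Longrightarrow> a \<bullet> v \<le> a \<bullet> w" and x: "x \<in> P"
  shows "a \<bullet> v \<le> a \<bullet> x"
proof (cases "x = v")
  case False
  have "{v} exposed_face_of P"
    using v exposed_face_of_polyhedron[OF polytope_imp_polyhedron[OF P]]
    by (simp add: vertices_def face_of_singleton)
  then obtain b0 c0 where b0: "P \<subseteq> {x. b0 \<bullet> x \<le> c0}" "{v} = P \<inter> {x. b0 \<bullet> x = c0}"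
    by (auto simp: exposed_face_of_def)
  define b where "b = - b0"
  have bv: "b \<bullet> v < b \<bullet> y" if "y \<in> P" "y \<noteq> v" for y
  proof -
    have "b0 \<bullet> v = c0" "b0 \<bullet> y \<le> c0" "b0 \<bullet> y \<noteq> c0" using b0 that by blast+
    then show ?thesis by (simp add: b_def)
  qed
  \<comment> \<open>The heights above \<open>v\<close> of the other vertices and of
    \<open>x\<close>. Half their minimum is a level strictly between \<open>v\<close> and all of
    them; \<open>x\<close> is included so that the segment from \<open>v\<close> to \<open>x\<close>
    reaches this level.\<close>
  define S where "S = (\<lambda>y. b \<bullet> y - b \<bullet> v) ` (insert x (vertices P - {v}))"
  have fS: "finite S" "S \<noteq> {}" using finite_vertices[OF P] by (auto simp: S_def)
  have Spos: "s > 0" if "s \<in> S" for s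
    using that bv[of x] bv x False subsetD[OF vertices_subset[of P]] unfolding S_def by fastforce
  define \<epsilon> where "\<epsilon> = Min S / 2"
  have \<epsilon>: "0 < \<epsilon>" "\<And>s. s \<in> S \<Longrightarrow> \<epsilon> < s"
    using Min_in[OF fS] Spos Min_le[OF fS(1)] unfolding \<epsilon>_def by force+
  let ?H = "{y. b \<bullet> y = b \<bullet> v + \<epsilon>}"
  have cH: "compact (P \<inter> ?H)" "convex (P \<inter> ?H)"
    using P by (auto simp: polytope_imp_compact polytope_imp_convex compact_Int_closed closed_hyperplane convex_Int convex_hyperplane)
  have ext: "a \<bullet> v \<le> a \<bullet> z" if z: "z extreme_point_of (P \<inter> ?H)" for z
  proof -
    have zP: "b \<bullet> z = b \<bullet> v + \<epsilon>" using z by (auto simp: extreme_point_of_def)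
    have nz: "y \<notin> vertices P" if "b \<bullet> v < b \<bullet> y" "b \<bullet> y \<le> b \<bullet> v + \<epsilon>" for y
      using that \<epsilon>(2)[of "b \<bullet> y - b \<bullet> v"] unfolding S_def by fastforce
    have "z \<notin> vertices P" using nz zP \<epsilon> by simp
    then obtain v' w where vw: "adjacent P v' w" "b \<bullet> v' < b \<bullet> v + \<epsilon>" "z \<in> open_segment v' w"
      using extreme_point_of_section[OF P z] by metis
    \<comment> \<open>The lower end of the crossing edge lies below the cutting level, and
      \<open>v\<close> is the only vertex there.\<close>
    have "v' = v"
      using nz[of v'] bv[of v'] vw adjacent_vertices[OF vw(1)] vertices_subset[of P] by force
    then have "a \<bullet> v \<le> a \<bullet> w" using a vw by (simp add: neighbours_def)
    moreover obtain t where "0 < t" "t < 1" "z = (1 - t) *\<^sub>R v + t *\<^sub>R w"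
      using vw \<open>v' = v\<close> by (auto simp: in_segment)
    moreover from this have "a \<bullet> z = (1 - t) * (a \<bullet> v) + t * (a \<bullet> w)" by (simp add: inner_add_right)
    ultimately have "a \<bullet> z - a \<bullet> v = t * (a \<bullet> w - a \<bullet> v)" by (simp add: algebra_simps)
    then show ?thesis using \<open>0 < t\<close> \<open>a \<bullet> v \<le> a \<bullet> w\<close>
      by (smt (verit) mult_nonneg_nonneg)
  qed
  define t where "t = \<epsilon> / (b \<bullet> x - b \<bullet> v)"
  have bx: "b \<bullet> x - b \<bullet> v > 0" using bv x False by simp
  have "\<epsilon> < b \<bullet> x - b \<bullet> v" using \<epsilon>(2) by (simp add: S_def)
  then have t: "0 < t" "t < 1" using \<epsilon> bx by (simp_all add: t_def)
  define y where "y = (1 - t) *\<^sub>R v + t *\<^sub>R x"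
  have "y \<in> P" unfolding y_def
    using t x v vertices_subset[of P] by (intro convexD_alt[OF polytope_imp_convex[OF P]]) auto
  moreover have "b \<bullet> y = b \<bullet> v + t * (b \<bullet> x - b \<bullet> v)" by (simp add: y_def inner_add_right algebra_simps)
  ultimately have "y \<in> P \<inter> ?H" using bx by (simp add: t_def)
  then have "y \<in> convex hull {z. z extreme_point_of (P \<inter> ?H)}"
    using Krein_Milman_Minkowski[OF cH] by simp
  also have "\<dots> \<subseteq> {z. a \<bullet> v \<le> a \<bullet> z}"
    by (rule hull_minimal) (use ext in \<open>auto simp: convex_halfspace_ge\<close>)
  finally have "a \<bullet> v \<le> a \<bullet> y" by simp
  moreover have "a \<bullet> y = a \<bullet> v + t * (a \<bullet> x - a \<bullet> v)" by (simp add: y_def inner_add_right algebra_simps)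
  ultimately have "0 \<le> t * (a \<bullet> x - a \<bullet> v)" by simp
  then show ?thesis using t by (simp add: zero_le_mult_iff)
qed simp

section \<open>Facets of simple polytopes\<close>

text \<open>Connectedness of the graph. If \<open>u\<close> were outside \<open>T\<close>, let
  \<open>b\<close> attain its maximum over \<open>P\<close> only at \<open>u\<close>. A vertex
  maximising \<open>b\<close> over \<open>T\<close> is a local maximum because \<open>T\<close>
  contains its neighbours, hence a global one, although it differs from \<open>u\<close>.\<close>

lemma neighbour_closed_vertices:
  assumes P: "polytope P" and T: "T \<subseteq> vertices P" "T \<noteq> {}"
    and closed: "\<And>v. v \<in> T \<Longrightarrow> neighbours P v \<subseteq> T"
  shows "T = vertices P"
proof (rule ccontr)
  assume "T \<noteq> vertices P"
  then obtain u where u: "u \<in> vertices P" "u \<notin> T" using T by blast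
  have "{u} exposed_face_of P"
    using u exposed_face_of_polyhedron[OF polytope_imp_polyhedron[OF P]]
    by (simp add: vertices_def face_of_singleton)
  then obtain b c where b: "P \<subseteq> {x. b \<bullet> x \<le> c}" "{u} = P \<inter> {x. b \<bullet> x = c}"
    by (auto simp: exposed_face_of_def)
  have fT: "finite T" using T finite_vertices[OF P] finite_subset by blast
  have "Max ((\<bullet>) b ` T) \<in> (\<bullet>) b ` T" using fT T by simp
  then obtain v where v: "v \<in> T" "b \<bullet> v = Max ((\<bullet>) b ` T)" by auto
  then have v_max: "b \<bullet> w \<le> b \<bullet> v" if "w \<in> T" for w using that fT by simp
  have vP: "v \<in> vertices P" using v(1) T(1) by blast
  have nb: "(-b) \<bullet> v \<le> (-b) \<bullet> w" if "w \<in> neighbours P v" for w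
    using v_max[of w] closed[OF v(1)] that by auto
  have uP: "u \<in> P" using u(1) vertices_subset by blast
  have "(-b) \<bullet> v \<le> (-b) \<bullet> u" by (rule vertex_minimum_of_neighbours[OF P vP nb uP])
  moreover have "b \<bullet> u = c" using b(2) by blast
  moreover have "v \<in> P" "v \<noteq> u" using vP vertices_subset v(1) u(2) by blast+
  then have "b \<bullet> v \<le> c" "b \<bullet> v \<noteq> c" using b by blast+
  ultimately show False by simp
qed

lemma vertex_constant_of_neighbours:
  fixes P :: "'a::euclidean_space set"
  assumes P: "polytope P" and v: "v \<in> vertices P"
    and a: "\<And>w. w \<in> neighbours P v \<Longrightarrow> a \<bullet> w = a \<bullet> v" and x: "x \<in> P"
  shows "a \<bullet> x = a \<bullet> v"
  using vertex_minimum_of_neighbours[OF P v, of a x] vertex_minimum_of_neighbours[OF P v, of "- a" x] a x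
  by force

lemma vertex_maximum_of_neighbours:
  fixes P :: "'a::euclidean_space set"
  assumes P: "polytope P" and v: "v \<in> vertices P"
    and a: "\<And>w. w \<in> neighbours P v \<Longrightarrow> a \<bullet> w \<le> a \<bullet> v" and x: "x \<in> P"
  shows "a \<bullet> x \<le> a \<bullet> v"
  using vertex_minimum_of_neighbours[OF P v, of "- a" x] a x by force

text \<open>The component of \<open>x\<close> orthogonal to the span serves as
  \<open>r\<close>.\<close>

lemma not_in_span_functional:
  fixes x :: "'a::euclidean_space"
  assumes "x \<notin> span B"
  obtains r where "\<And>b. b \<in> B \<Longrightarrow> r \<bullet> b = 0" "r \<bullet> x > 0"
proof -
  obtain y z where yz: "y \<in> span B" "\<And>w. w \<in> span B \<Longrightarrow> orthogonal z w" "x = y + z"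
    using orthogonal_subspace_decomp_exists[of B x] by metis
  have "z \<noteq> 0" using assms yz by auto
  then have "z \<bullet> x > 0" using yz by (simp add: inner_add_right orthogonal_def)
  then show ?thesis using that[of z] yz(2) by (simp add: orthogonal_def span_base)
qed

text \<open>The edge directions at \<open>v\<close> span all directions of \<open>P\<close>: a
  functional vanishing on them is constant on the neighbours of \<open>v\<close>, hence on
  \<open>P\<close>.\<close>

lemma aff_dim_le_card_neighbours:
  fixes P :: "'a::euclidean_space set"
  assumes P: "polytope P" and v: "v \<in> vertices P"
  shows "aff_dim P \<le> int (card (neighbours P v))"
proof -
  let ?D = "(\<lambda>w. w - v) ` neighbours P v"
  have "x - v \<in> span ?D" if x: "x \<in> P" for x
  proof (rule ccontr)
    assume "x - v \<notin> span ?D"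
    then obtain r where r: "\<And>d. d \<in> ?D \<Longrightarrow> r \<bullet> d = 0" "r \<bullet> (x - v) > 0"
      using not_in_span_functional by metis
    have "r \<bullet> x = r \<bullet> v"
      using r(1) by (intro vertex_constant_of_neighbours[OF P v _ x]) (force simp: inner_diff_right)
    then show False using r by (simp add: inner_diff_right)
  qed
  then have "P \<subseteq> (+) v ` span ?D"
    by (force simp: image_iff intro!: bexI[of _ "_ - v"])
  then have "aff_dim P \<le> aff_dim ((+) v ` span ?D)" by (rule aff_dim_subset)
  also have "\<dots> = int (dim ?D)" by (simp add: aff_dim_translation_eq aff_dim_subspace)
  also have "\<dots> \<le> int (card ?D)" using finite_neighbours[OF P] by (simp add: dim_le_card')
  also have "\<dots> \<le> int (card (neighbours P v))"
    using finite_neighbours[OF P] by (simp add: card_image_le)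
  finally show ?thesis .
qed

text \<open>A facet containing \<open>v\<close> and all its neighbours would have a supporting
  functional constant on \<open>P\<close>, so at least one neighbour is missing. The lower bound on
  degrees, applied to \<open>F\<close>, allows no more than one to be missing.\<close>

lemma card_facet_neighbours:
  fixes P :: "'a::euclidean_space set"
  assumes P: "polytope P" and v: "v \<in> vertices P"
    and d: "int (card (neighbours P v)) = aff_dim P"
    and F: "F facet_of P" "v \<in> F"
  shows "Suc (card (neighbours F v)) = card (neighbours P v)"
proof -
  have fF: "F face_of P" "aff_dim F = aff_dim P - 1" using F by (auto simp: facet_of_def)
  have pF: "polytope F" using fF P face_of_polytope_polytope by blast
  have vF: "v \<in> vertices F" using v F vertices_face[OF fF(1)] by simp
  have sub: "neighbours F v \<subseteq> neighbours P v" using neighbours_face[OF fF(1) F(2)] by simp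
  have "neighbours F v \<noteq> neighbours P v"
  proof
    assume "neighbours F v = neighbours P v"
    then have N: "neighbours P v \<subseteq> F" using neighbours_face[OF fF(1) F(2)] by auto
    have "F exposed_face_of P"
      using fF exposed_face_of_polyhedron[OF polytope_imp_polyhedron[OF P]] by simp
    then obtain b c where b: "P \<subseteq> {x. b \<bullet> x \<le> c}" "F = P \<inter> {x. b \<bullet> x = c}"
      by (auto simp: exposed_face_of_def)
    have "b \<bullet> x = b \<bullet> v" if "x \<in> P" for x
      using N b F by (intro vertex_constant_of_neighbours[OF P v _ that]) auto
    then have "F = P" using b F by auto
    then show False using fF by simp
  qed
  then have "card (neighbours F v) < card (neighbours P v)"
    using sub finite_neighbours[OF P] by (metis psubsetI psubset_card_mono)
  moreover have "int (card (neighbours P v)) - 1 \<le> int (card (neighbours F v))"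
    using aff_dim_le_card_neighbours[OF pF vF] fF d by simp
  ultimately show ?thesis by simp
qed

text \<open>The edge directions at \<open>v\<close> other than that of \<open>y\<close> are too few
  to span the space, so some functional is constant on \<open>v\<close> and these neighbours. It
  differs at \<open>y\<close> because \<open>P\<close> is full-dimensional; with the sign that puts
  \<open>y\<close> lower, \<open>v\<close> is a local and hence global maximum.\<close>

lemma facet_omitting_neighbour:
  fixes P :: "'a::euclidean_space set"
  assumes P: "polytope P" and v: "v \<in> vertices P"
    and d: "int (card (neighbours P v)) = aff_dim P" and full: "aff_dim P = int DIM('a)"
    and y: "y \<in> neighbours P v"
  obtains G where "G facet_of P" "v \<in> G" "neighbours G v = neighbours P v - {y}"
proof -
  let ?N = "neighbours P v"
  let ?D = "(\<lambda>w. w - v) ` (?N - {y})"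
  note fin = finite_neighbours[OF P]
  have "dim ?D \<le> card ?D" by (rule dim_le_card') (use fin in simp)
  also have "\<dots> \<le> card (?N - {y})" using fin by (simp add: card_image_le)
  also have "\<dots> < DIM('a)" using d full y fin by simp
  finally obtain a0 where a0: "a0 \<noteq> 0" "span ?D \<subseteq> {x. a0 \<bullet> x = 0}"
    using lowdim_subset_hyperplane by blast
  have a0D: "a0 \<bullet> w = a0 \<bullet> v" if "w \<in> ?N" "w \<noteq> y" for w
    using a0(2) span_base[of "w - v" ?D] that by (force simp: inner_diff_right)
  have "a0 \<bullet> y \<noteq> a0 \<bullet> v"
  proof
    assume "a0 \<bullet> y = a0 \<bullet> v"
    then have "P \<subseteq> {x. a0 \<bullet> x = a0 \<bullet> v}"
      using a0D vertex_constant_of_neighbours[OF P v, of a0] by blast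
    then have "aff_dim P \<le> aff_dim {x. a0 \<bullet> x = a0 \<bullet> v}" by (rule aff_dim_subset)
    then show False using full a0 by (simp add: aff_dim_hyperplane)
  qed
  then obtain a where a: "a \<bullet> y < a \<bullet> v" "\<And>w. w \<in> ?N \<Longrightarrow> w \<noteq> y \<Longrightarrow> a \<bullet> w = a \<bullet> v"
    using that a0D by (cases "a0 \<bullet> y < a0 \<bullet> v") (force intro: that[of a0] that[of "- a0"])+
  have le: "a \<bullet> x \<le> a \<bullet> v" if "x \<in> P" for x
    using a by (intro vertex_maximum_of_neighbours[OF P v _ that]) (metis less_imp_le order_refl)
  define C where "C = P \<inter> {x. a \<bullet> x = a \<bullet> v}"
  have C: "C face_of P" unfolding C_def
    using le by (intro face_of_Int_supporting_hyperplane_le polytope_imp_convex[OF P])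
  have vC: "v \<in> C" using v vertices_subset[of P] by (auto simp: C_def)
  have NP: "?N \<subseteq> P" using neighbours_subset_vertices vertices_subset by blast
  have "y \<notin> C" "y \<in> P" using a y NP by (auto simp: C_def)
  \<comment> \<open>The face \<open>C\<close> of maximisers is only enlarged to some facet; the
    neighbour count then shows that the facet still misses \<open>y\<close>.\<close>
  then obtain G where G: "G facet_of P" "C \<subseteq> G"
    using face_of_polyhedron_subset_facet[OF polytope_imp_polyhedron[OF P] C] vC by blast
  have fG: "G face_of P" using G facet_of_imp_face_of by blast
  have vG: "v \<in> G" using G vC by blast
  have "?N - {y} \<subseteq> neighbours G v"
    using neighbours_face[OF fG vG] a(2) NP G(2) by (auto simp: C_def)
  moreover have "card (neighbours G v) = card (?N - {y})"
    using card_facet_neighbours[OF P v d G(1) vG] y fin by simp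
  ultimately have "?N - {y} = neighbours G v"
    by (intro card_subset_eq finite_neighbours face_of_polytope_polytope[OF P fG]) auto
  then show ?thesis using that G vG by metis
qed

section \<open>Functionals separating two neighbours of a vertex\<close>

lemma interior_zero_not_halfspace:
  fixes P :: "'a::euclidean_space set"
  assumes "0 \<in> interior P" "f \<noteq> 0"
  obtains x where "x \<in> P" "f \<bullet> x < 0"
proof -
  obtain e where e: "e > 0" "ball 0 e \<subseteq> P" using assms by (auto simp: mem_interior)
  define x where "x = (- e / (2 * norm f)) *\<^sub>R f"
  have "x \<in> P" using e assms by (intro subsetD[OF e(2)]) (simp add: x_def)
  moreover have "f \<bullet> x < 0" using e assms by (simp add: x_def)
  ultimately show ?thesis using that by blast
qed

text \<open>The vertex \<open>w\<close> and its other neighbours are too few to span, so a nonzero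
  \<open>f\<close> vanishes on them. Were \<open>f\<close> nonnegative at both \<open>x\<close> and
  \<open>y\<close>, then \<open>w\<close> would minimise it with value 0, against 0 being interior.
  The same holds for \<open>- f\<close>, so the two values have strictly opposite signs.\<close>

lemma separating_functional:
  fixes P :: "'a::euclidean_space set"
  assumes P: "polytope P" and w: "w \<in> vertices P" and zero: "0 \<in> interior P"
    and d: "card (neighbours P w) = DIM('a)"
    and xy: "x \<in> neighbours P w" "y \<in> neighbours P w" "x \<noteq> y"
  obtains f where "f \<bullet> w = 0" "\<And>m. m \<in> neighbours P w - {x, y} \<Longrightarrow> f \<bullet> m = 0"
    "f \<bullet> x < 0" "f \<bullet> y > 0"
proof -
  let ?N = "neighbours P w"
  let ?B = "insert w (?N - {x, y})"
  note fin = finite_neighbours[OF P]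
  have "card (?N - {x, y}) = card ?N - 2" using xy fin by (subst card_Diff_subset) auto
  moreover have "2 \<le> card ?N" using xy fin card_mono[of ?N "{x, y}"] by simp
  ultimately have "Suc (card (?N - {x, y})) < DIM('a)" using d by linarith
  then have c: "card ?B < DIM('a)" using fin by (simp add: card_insert_if)
  have "dim ?B \<le> card ?B" by (rule dim_le_card') (use fin in simp)
  then obtain f where f: "f \<noteq> 0" "span ?B \<subseteq> {x. f \<bullet> x = 0}"
    using c lowdim_subset_hyperplane[of ?B] by auto
  then have fB: "f \<bullet> b = 0" if "b \<in> ?B" for b using span_base[OF that] by blast
  have neg: "g \<bullet> x < 0 \<or> g \<bullet> y < 0" if g: "g \<noteq> 0" "\<And>b. b \<in> ?B \<Longrightarrow> g \<bullet> b = 0" for g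
  proof (rule ccontr)
    assume "\<not> ?thesis"
    then have "g \<bullet> w \<le> g \<bullet> m" if "m \<in> ?N" for m using g(2)[of w] g(2)[of m] that by (cases "m \<in> {x, y}") auto
    then have "0 \<le> g \<bullet> z" if "z \<in> P" for z
      using vertex_minimum_of_neighbours[OF P w _ that, of g] g(2)[of w] by simp
    moreover obtain z where "z \<in> P" "g \<bullet> z < 0"
      using interior_zero_not_halfspace[OF zero g(1)] by metis
    ultimately show False by (meson not_le)
  qed
  have "f \<bullet> x < 0 \<or> f \<bullet> y < 0" "(- f) \<bullet> x < 0 \<or> (- f) \<bullet> y < 0"
    using neg[of f] neg[of "-f"] f fB by auto
  then consider "f \<bullet> x < 0" "f \<bullet> y > 0" | "(- f) \<bullet> x < 0" "(- f) \<bullet> y > 0" by fastforce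
  then show ?thesis
  proof cases
    case 1
    then show ?thesis using that[of f] fB by blast
  next
    case 2
    have "(- f) \<bullet> b = 0" if "b \<in> ?B" for b using fB[OF that] by simp
    then show ?thesis using that[of "- f"] 2 by blast
  qed
qed

section \<open>Face lattices from facets\<close>

text \<open>A facet \<open>G\<close> is chosen to match \<open>F\<close> at one vertex, and the
  match spreads along the edges of \<open>F\<close> by connectedness. Equal signs of the multipliers
  at the ends of an edge make inequalities at neighbours of one vertex transferable between
  \<open>P\<close> and \<open>Q\<close>.\<close>

lemma facet_transfer:
  fixes P Q :: "'a::euclidean_space set" and c :: "'a \<Rightarrow> real"
  assumes P: "polytope P" and Q: "polytope Q"
    and zero: "0 \<in> interior P"
    and full: "aff_dim P = int DIM('a)" "aff_dim Q = int DIM('a)"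
    and dP: "\<And>v. v \<in> vertices P \<Longrightarrow> card (neighbours P v) = DIM('a)"
    and dQ: "\<And>v. v \<in> vertices Q \<Longrightarrow> card (neighbours Q v) = DIM('a)"
    and inj: "inj_on (\<lambda>v. c v *\<^sub>R v) (vertices P)"
    and img: "(\<lambda>v. c v *\<^sub>R v) ` vertices P = vertices Q"
    and adj: "\<And>v w. v \<in> vertices P \<Longrightarrow> w \<in> vertices P \<Longrightarrow>
      adjacent Q (c v *\<^sub>R v) (c w *\<^sub>R w) \<longleftrightarrow> adjacent P v w"
    and pos: "\<And>v w. adjacent P v w \<Longrightarrow> c v * c w > 0"
    and F: "F facet_of P"
  obtains G where "G facet_of Q" "vertices Q \<inter> G = (\<lambda>v. c v *\<^sub>R v) ` (vertices P \<inter> F)"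
proof -
  define \<pi> where "\<pi> = (\<lambda>v. c v *\<^sub>R v)"
  have inj: "inj_on \<pi> (vertices P)" and img: "\<pi> ` vertices P = vertices Q"
    using inj img by (simp_all add: \<pi>_def)
  have fF: "F face_of P" and pF: "polytope F" and vF: "vertices F = vertices P \<inter> F"
    using F facet_of_imp_face_of vertices_face P face_of_polytope_polytope by blast+
  have NQ: "neighbours Q (\<pi> v) = \<pi> ` neighbours P v" if v: "v \<in> vertices P" for v
  proof (intro set_eqI iffI)
    fix y assume "y \<in> neighbours Q (\<pi> v)"
    moreover from this obtain w where "w \<in> vertices P" "y = \<pi> w"
      using img neighbours_subset_vertices by blast
    ultimately show "y \<in> \<pi> ` neighbours P v" using adj[OF v] by (auto simp: neighbours_def \<pi>_def)
  qed (use adj[OF v] neighbours_subset_vertices in \<open>fastforce simp: neighbours_def \<pi>_def\<close>)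
  have "F \<noteq> {}" using F by (auto simp: facet_of_def)
  then have "vertices F \<noteq> {}" using polytope_eq_hull_vertices[OF pF] by auto
  then obtain v0 where v0: "v0 \<in> vertices P" "v0 \<in> F" using vF by auto
  have card_NF: "Suc (card (neighbours F v)) = DIM('a)" if "v \<in> vertices P" "v \<in> F" for v
    using card_facet_neighbours[OF P that(1) _ F that(2)] dP full that by simp
  have NFP: "neighbours F v \<subseteq> neighbours P v" if "v \<in> F" for v
    using neighbours_face[OF fF that] by simp
  have "neighbours F v0 \<noteq> neighbours P v0" using card_NF[OF v0] dP[OF v0(1)] by auto
  then obtain y0 where y0: "y0 \<in> neighbours P v0" "y0 \<notin> neighbours F v0" using NFP v0 by blast
  have NF0: "neighbours F v0 = neighbours P v0 - {y0}"
    using NFP[OF v0(2)] y0 card_NF[OF v0] dP[OF v0(1)] finite_neighbours[OF P]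
    by (intro card_subset_eq) auto
  have \<pi>v0: "\<pi> v0 \<in> vertices Q" using img v0 by blast
  have "\<pi> y0 \<in> neighbours Q (\<pi> v0)" using NQ v0 y0 by simp
  then obtain G where G: "G facet_of Q" "\<pi> v0 \<in> G"
    "neighbours G (\<pi> v0) = neighbours Q (\<pi> v0) - {\<pi> y0}"
    using facet_omitting_neighbour[OF Q \<pi>v0 _ full(2)] dQ[OF \<pi>v0] full by metis
  have fG: "G face_of Q" and pG: "polytope G" and vG: "vertices G = vertices Q \<inter> G"
    using G facet_of_imp_face_of vertices_face Q face_of_polytope_polytope by blast+
  \<comment> \<open>The vertices of \<open>F\<close> at which \<open>G\<close> matches
    \<open>F\<close> locally. Closure of \<open>T\<close> under neighbours in \<open>F\<close> is
    what remains to be shown.\<close>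
  define T where "T = {v \<in> vertices F. \<pi> v \<in> G \<and> neighbours G (\<pi> v) = \<pi> ` neighbours F v}"
  have "neighbours G (\<pi> v0) = \<pi> ` neighbours F v0"
    unfolding G(3) NQ[OF v0(1)] NF0
    using inj_on_image_set_diff[OF inj, of "neighbours P v0" "{y0}"] neighbours_subset_vertices y0 by auto
  then have "v0 \<in> T" using v0 G vF by (auto simp: T_def)
  have closed: "w \<in> T" if v: "v \<in> T" and w: "w \<in> neighbours F v" for v w
  proof -
    have vv: "v \<in> vertices P" "v \<in> F" "\<pi> v \<in> G" "neighbours G (\<pi> v) = \<pi> ` neighbours F v"
      using v vF by (auto simp: T_def)
    have vF': "v \<in> vertices F" using v by (simp add: T_def)
    have ww: "w \<in> vertices P" "w \<in> F" "w \<in> vertices F"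
      using w neighbours_subset_vertices[of F v] vF by auto
    have avw: "adjacent P v w" using w NFP[OF vv(2)] by (auto simp: neighbours_def)
    have \<pi>w: "\<pi> w \<in> vertices G" using vv(4) w neighbours_subset_vertices by blast
    then have \<pi>wQ: "\<pi> w \<in> vertices Q" "\<pi> w \<in> G" using vG by auto
    have "neighbours G (\<pi> w) = \<pi> ` neighbours F w"
    proof (rule ccontr)
      assume ne: "neighbours G (\<pi> w) \<noteq> \<pi> ` neighbours F w"
      have "neighbours G (\<pi> w) \<subseteq> \<pi> ` neighbours P w"
        using neighbours_face[OF fG \<pi>wQ(2)] NQ[OF ww(1)] by auto
      \<comment> \<open>\<open>A\<close> consists of the neighbours of \<open>w\<close> whose images
        lie in \<open>G\<close>. In the case of a mismatch it omits some \<open>y\<close> that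
        belongs to \<open>F\<close>, while \<open>F\<close> omits another neighbour
        \<open>x\<close>.\<close>
      then obtain A where A: "A \<subseteq> neighbours P w" "neighbours G (\<pi> w) = \<pi> ` A"
        by (meson subset_imageE)
      have injN: "inj_on \<pi> (neighbours P w)" using inj neighbours_subset_vertices inj_on_subset by blast
      have "card A = card (neighbours G (\<pi> w))"
        using A card_image inj_on_subset[OF injN] by metis
      also have "Suc \<dots> = DIM('a)"
        using card_facet_neighbours[OF Q \<pi>wQ(1) _ G(1) \<pi>wQ(2)] dQ[OF \<pi>wQ(1)] full by simp
      finally have cA: "Suc (card A) = DIM('a)" .
      have fA: "finite A" using A finite_neighbours[OF P] finite_subset by blast
      have fN: "finite (neighbours F w)" by (rule finite_neighbours[OF pF])
      have "A \<noteq> neighbours F w" using ne A by auto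
      moreover have "card A = card (neighbours F w)" using cA card_NF[OF ww(1,2)] by simp
      ultimately have "\<not> neighbours F w \<subseteq> A" using card_subset_eq[OF fA, of "neighbours F w"] by auto
      then obtain y where y: "y \<in> neighbours F w" "y \<notin> A" by blast
      have yP: "y \<in> neighbours P w" using y NFP[OF ww(2)] by blast
      have "A = neighbours P w - {y}"
        using A(1) y yP cA dP[OF ww(1)] finite_neighbours[OF P]
        by (intro card_subset_eq) auto
      moreover have "neighbours F w \<noteq> neighbours P w" using card_NF[OF ww(1,2)] dP[OF ww(1)] by auto
      ultimately obtain x where x: "x \<in> neighbours P w" "x \<notin> neighbours F w" "x \<noteq> y"
        using y NFP[OF ww(2)] by blast
      obtain f where f: "f \<bullet> w = 0" "\<And>m. m \<in> neighbours P w - {x, y} \<Longrightarrow> f \<bullet> m = 0"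
          "f \<bullet> x < 0" "f \<bullet> y > 0"
        using separating_functional[OF P ww(1) zero dP[OF ww(1)] x(1) yP x(3)] by metis
      \<comment> \<open>On \<open>A\<close> the functional is negative at \<open>x\<close> and zero
        elsewhere, since \<open>y\<close> is missing from \<open>A\<close>.\<close>
      have fA: "f \<bullet> m \<le> 0" if "m \<in> A" for m
        using f(2)[of m] f(3) that A(1) y(2)
        by (metis DiffI empty_iff insert_iff less_imp_le order_refl subsetD)
      \<comment> \<open>Scaling by \<open>c w\<close> makes the value at the image of
        \<open>m\<close> equal to \<open>c w * c m\<close> times \<open>f \<bullet> m\<close>, and
        the first factor is positive along an edge. So \<open>\<pi> w\<close> is a local maximum on
        \<open>G\<close>.\<close>
      have G_le: "(c w *\<^sub>R f) \<bullet> z \<le> (c w *\<^sub>R f) \<bullet> \<pi> w" if "z \<in> G" for z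
      proof (rule vertex_maximum_of_neighbours[OF pG \<pi>w _ that])
        fix n assume "n \<in> neighbours G (\<pi> w)"
        then obtain m where m: "m \<in> A" "n = \<pi> m" using A by auto
        then have "c w * c m > 0" using pos A by (auto simp: neighbours_def)
        then have "(c w * c m) * (f \<bullet> m) \<le> 0" using fA[OF m(1)] by (simp add: mult_nonneg_nonpos)
        then show "(c w *\<^sub>R f) \<bullet> n \<le> (c w *\<^sub>R f) \<bullet> \<pi> w" using f(1) m by (simp add: \<pi>_def ac_simps)
      qed
      have "v \<in> neighbours F w" using w by (simp add: neighbours_def adjacent_commute)
      moreover have "\<pi> v \<in> \<pi> ` A"
        using A(2) neighbours_face[OF fG \<pi>wQ(2)] NQ[OF ww(1)] vv(3) avw
        by (auto simp: neighbours_def adjacent_commute)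
      then have "v \<in> A"
        using A(1) neighbours_subset_vertices inj vv(1) by (metis inj_on_image_mem_iff subset_trans)
      \<comment> \<open>As a neighbour of \<open>w\<close> in both \<open>F\<close> and
        \<open>A\<close>, the vertex \<open>v\<close> is neither \<open>x\<close> nor
        \<open>y\<close>.\<close>
      ultimately have fv: "f \<bullet> v = 0" using f(2)[of v] x y A by (cases "v \<in> {x, y}") auto
      \<comment> \<open>The match at \<open>v\<close> puts the images of its neighbours
        \<open>n\<close> in \<open>F\<close> into \<open>G\<close>. There \<open>c w\<close> and
        \<open>c n\<close> both have the sign of \<open>c v\<close>, so the bound on
        \<open>G\<close> gives \<open>f \<bullet> n \<le> 0\<close>. Thus \<open>v\<close> maximises
        \<open>f\<close> on \<open>F\<close> with value 0, which contradicts
        \<open>f \<bullet> y > 0\<close>.\<close>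
      have "f \<bullet> y \<le> f \<bullet> v"
      proof (rule vertex_maximum_of_neighbours[OF pF vF'])
        show "y \<in> F" using y neighbours_face[OF fF ww(2)] by simp
        fix n assume n: "n \<in> neighbours F v"
        then have "\<pi> n \<in> G" using vv(4) neighbours_face[OF fG vv(3)] by blast
        then have "(c w * c n) * (f \<bullet> n) \<le> 0" using G_le[of "\<pi> n"] f(1) by (simp add: \<pi>_def ac_simps)
        moreover have "c v * c n > 0" using n NFP[OF vv(2)] pos by (auto simp: neighbours_def)
        moreover have "c v * c w > 0" using pos avw by blast
        ultimately show "f \<bullet> n \<le> f \<bullet> v"
          unfolding fv by (auto simp: zero_less_mult_iff mult_le_0_iff)
      qed
      then show False using f fv by simp
    qed
    then show "w \<in> T" using ww \<pi>wQ by (simp add: T_def)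
  qed
  have "T = vertices F"
  proof (rule neighbour_closed_vertices[OF pF])
    show "T \<subseteq> vertices F" unfolding T_def by blast
    show "T \<noteq> {}" using \<open>v0 \<in> T\<close> by blast
  qed (use closed in blast)
  then have T: "\<pi> v \<in> G" "neighbours G (\<pi> v) = \<pi> ` neighbours F v" if "v \<in> vertices F" for v
    using that by (auto simp: T_def)
  \<comment> \<open>Connectedness is used a second time, now in \<open>G\<close>: the local matches
    make the image of the vertices of \<open>F\<close> closed under neighbours.\<close>
  have "\<pi> ` vertices F = vertices G"
  proof (rule neighbour_closed_vertices[OF pG])
    show "\<pi> ` vertices F \<subseteq> vertices G" using T vG vF img by auto
    show "\<pi> ` vertices F \<noteq> {}" using v0 vF by auto
    show "neighbours G y \<subseteq> \<pi> ` vertices F" if "y \<in> \<pi> ` vertices F" for y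
      using that T neighbours_subset_vertices by blast
  qed
  then show ?thesis using that[OF G(1)] vF vG by (simp add: \<pi>_def)
qed

section \<open>From matched facets to an isomorphism of face lattices\<close>

text \<open>A nonempty proper face is the intersection of the facets containing it, and an injective
  map commutes with intersections of vertex sets.\<close>

lemma face_from_facets:
  assumes P: "polytope P" and Q: "polytope Q"
    and inj: "inj_on \<pi> (vertices P)" and img: "\<pi> ` vertices P = vertices Q"
    and facets: "\<And>F. F facet_of P \<Longrightarrow> \<exists>G. G facet_of Q \<and> vertices Q \<inter> G = \<pi> ` (vertices P \<inter> F)"
    and F: "F face_of P"
  shows "\<exists>G. G face_of Q \<and> vertices Q \<inter> G = \<pi> ` (vertices P \<inter> F)"
proof -
  consider "F = {}" | "F = P" | "F \<noteq> {}" "F \<noteq> P" by blast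
  then show ?thesis
  proof cases
    case 1
    then show ?thesis by (intro exI[of _ "{}"]) simp
  next
    case 2
    have "vertices Q \<inter> Q = \<pi> ` (vertices P \<inter> F)"
      using img 2 vertices_subset[of P] vertices_subset[of Q] by (simp add: Int_absorb2)
    then show ?thesis using face_of_refl[OF polytope_imp_convex[OF Q]] by blast
  next
    case 3
    define \<F> where "\<F> = {H. H facet_of P \<and> F \<subseteq> H}"
    have F_eq: "F = \<Inter>\<F>"
      unfolding \<F>_def using face_of_polyhedron[OF polytope_imp_polyhedron[OF P] F 3] .
    have ne: "\<F> \<noteq> {}"
      unfolding \<F>_def using face_of_polyhedron_subset_facet[OF polytope_imp_polyhedron[OF P] F 3] by blast
    obtain g where g: "\<And>H. H \<in> \<F> \<Longrightarrow> g H facet_of Q \<and> vertices Q \<inter> g H = \<pi> ` (vertices P \<inter> H)"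
      using facets unfolding \<F>_def by (metis mem_Collect_eq)
    have "vertices Q \<inter> \<Inter>(g ` \<F>) = (\<Inter>H\<in>\<F>. vertices Q \<inter> g H)" using ne by auto
    also have "\<dots> = (\<Inter>H\<in>\<F>. \<pi> ` (vertices P \<inter> H))" using g by simp
    also have "\<dots> = \<pi> ` (\<Inter>H\<in>\<F>. vertices P \<inter> H)"
      using image_INT[OF inj, of \<F> "\<lambda>H. vertices P \<inter> H"] ne by auto
    also have "(\<Inter>H\<in>\<F>. vertices P \<inter> H) = vertices P \<inter> \<Inter>\<F>" using ne by auto
    finally have "vertices Q \<inter> \<Inter>(g ` \<F>) = \<pi> ` (vertices P \<inter> F)" unfolding F_eq[symmetric] .
    moreover have "\<Inter>(g ` \<F>) face_of Q" using ne g by (intro face_of_Inter) (auto simp: facet_of_imp_face_of)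
    ultimately show ?thesis by blast
  qed
qed

lemma face_eq_hull_vertices:
  assumes "polytope P" "F face_of P"
  shows "F = convex hull (vertices P \<inter> F)"
  using polytope_eq_hull_vertices[OF face_of_polytope_polytope[OF assms]]
  unfolding vertices_face[OF assms(2)] .

text \<open>Faces are hulls of their vertices, so mapping vertex sets determines a map of faces and
  reflects inclusion. Surjectivity comes from \<open>face_from_facets\<close> applied to the inverse
  vertex map.\<close>

lemma combinatorially_equivalent_if_facets:
  fixes P :: "'a::euclidean_space set" and Q :: "'b::euclidean_space set"
  assumes P: "polytope P" and Q: "polytope Q"
    and inj: "inj_on \<pi> (vertices P)" and img: "\<pi> ` vertices P = vertices Q"
    and PQ: "\<And>F. F facet_of P \<Longrightarrow> \<exists>G. G facet_of Q \<and> vertices Q \<inter> G = \<pi> ` (vertices P \<inter> F)"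
    and QP: "\<And>G. G facet_of Q \<Longrightarrow> \<exists>F. F facet_of P \<and> vertices Q \<inter> G = \<pi> ` (vertices P \<inter> F)"
  shows "combinatorially_equivalent P Q"
proof -
  define f where "f F = convex hull (\<pi> ` (vertices P \<inter> F))" for F
  have f: "f F face_of Q" "vertices Q \<inter> f F = \<pi> ` (vertices P \<inter> F)" if "F face_of P" for F
  proof -
    obtain G where G: "G face_of Q" "vertices Q \<inter> G = \<pi> ` (vertices P \<inter> F)"
      using face_from_facets[OF P Q inj img PQ \<open>F face_of P\<close>] by blast
    have "f F = G" unfolding f_def G(2)[symmetric] by (rule face_eq_hull_vertices[OF Q G(1), symmetric])
    then show "f F face_of Q" "vertices Q \<inter> f F = \<pi> ` (vertices P \<inter> F)" using G by auto
  qed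
  have mono: "F \<subseteq> F' \<longleftrightarrow> f F \<subseteq> f F'" if F: "F face_of P" "F' face_of P" for F F'
  proof
    show "F \<subseteq> F' \<Longrightarrow> f F \<subseteq> f F'" unfolding f_def by (intro hull_mono) auto
    assume "f F \<subseteq> f F'"
    then have "\<pi> ` (vertices P \<inter> F) \<subseteq> \<pi> ` (vertices P \<inter> F')" using f(2) F by blast
    then have "vertices P \<inter> F \<subseteq> vertices P \<inter> F'"
      by (simp add: inj_on_image_subset_iff[OF inj])
    then have "convex hull (vertices P \<inter> F) \<subseteq> convex hull (vertices P \<inter> F')" by (rule hull_mono)
    then show "F \<subseteq> F'" by (simp only: face_eq_hull_vertices[OF P F(1), symmetric] face_eq_hull_vertices[OF P F(2), symmetric])
  qed
  define \<rho> where "\<rho> = inv_into (vertices P) \<pi>"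
  have \<rho>: "inj_on \<rho> (vertices Q)" "\<rho> ` vertices Q = vertices P"
    unfolding \<rho>_def using bij_betw_inv_into[of \<pi> "vertices P" "vertices Q"] inj img
    by (simp_all add: bij_betw_def)
  have \<rho>\<pi>: "\<rho> ` \<pi> ` A = A" if "A \<subseteq> vertices P" for A
    unfolding \<rho>_def using inv_into_image_cancel[OF inj that] .
  have QP': "\<exists>F. F facet_of P \<and> vertices P \<inter> F = \<rho> ` (vertices Q \<inter> G)" if "G facet_of Q" for G
    using QP[OF that] \<rho>\<pi> by (metis inf_le1)
  have surj: "\<exists>F. F face_of P \<and> f F = G" if G: "G face_of Q" for G
  proof -
    obtain F where F: "F face_of P" "vertices P \<inter> F = \<rho> ` (vertices Q \<inter> G)"
      using face_from_facets[OF Q P \<rho> QP' G] by blast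
    have "\<pi> ` \<rho> ` (vertices Q \<inter> G) = vertices Q \<inter> G"
      unfolding \<rho>_def using img by (simp add: image_inv_into_cancel)
    then have "f F = G" unfolding f_def F(2) by (simp only: face_eq_hull_vertices[OF Q G, symmetric])
    then show ?thesis using F by blast
  qed
  have "bij_betw f {F. F face_of P} {G. G face_of Q}"
    unfolding bij_betw_def
  proof
    show "inj_on f {F. F face_of P}"
    proof (rule inj_onI)
      fix F F' assume "F \<in> {F. F face_of P}" "F' \<in> {F. F face_of P}" "f F = f F'"
      then show "F = F'" using mono[of F F'] mono[of F' F] by blast
    qed
    show "f ` {F. F face_of P} = {G. G face_of Q}" using f(1) surj by auto
  qed
  then show ?thesis unfolding combinatorially_equivalent_def using mono by blast
qed

section \<open>Counting the vertices of a section\<close>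

text \<open>The point where the line through \<open>v\<close> and \<open>w\<close> meets the
  hyperplane orthogonal to \<open>u\<close>, meaningful when
  \<open>u \<bullet> v \<noteq> u \<bullet> w\<close>.\<close>

definition crossing :: "'a::euclidean_space \<Rightarrow> 'a \<Rightarrow> 'a \<Rightarrow> 'a"
  where "crossing u v w = (1 - (u \<bullet> v) / (u \<bullet> v - u \<bullet> w)) *\<^sub>R v + ((u \<bullet> v) / (u \<bullet> v - u \<bullet> w)) *\<^sub>R w"

lemma closed_segment_Int_hyperplane:
  assumes "u \<bullet> v < 0" "0 < u \<bullet> w"
  shows "closed_segment v w \<inter> {x. u \<bullet> x = 0} = {crossing u v w}" "crossing u v w \<in> open_segment v w"
proof -
  let ?t = "(u \<bullet> v) / (u \<bullet> v - u \<bullet> w)"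
  have t: "0 < ?t" "?t < 1" using assms by (simp_all add: field_simps)
  have "v \<noteq> w" using assms by auto
  then show o: "crossing u v w \<in> open_segment v w"
    using t unfolding crossing_def in_segment by blast
  have "u \<bullet> ((1 - t) *\<^sub>R v + t *\<^sub>R w) = (u \<bullet> v) - t * (u \<bullet> v - u \<bullet> w)" for t
    by (simp add: inner_add_right algebra_simps)
  then have "u \<bullet> crossing u v w = (u \<bullet> v) - ?t * (u \<bullet> v - u \<bullet> w)" unfolding crossing_def .
  then have 0: "u \<bullet> crossing u v w = 0" using assms by simp
  have "x = crossing u v w" if x: "x \<in> closed_segment v w" "u \<bullet> x = 0" for x
  proof -
    obtain s where s: "x = (1 - s) *\<^sub>R v + s *\<^sub>R w" using x by (auto simp: in_segment)
    then have "(1 - s) * (u \<bullet> v) + s * (u \<bullet> w) = 0" using x by (simp add: inner_add_right)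
    then have "s * (u \<bullet> v - u \<bullet> w) = u \<bullet> v" by (simp add: algebra_simps)
    then have "s = ?t" using assms by (simp add: eq_divide_eq)
    then show ?thesis using s by (simp add: crossing_def)
  qed
  then show "closed_segment v w \<inter> {x. u \<bullet> x = 0} = {crossing u v w}"
    using o 0 by (auto simp: open_segment_def)
qed

text \<open>Conversely to \<open>extreme_point_of_section\<close>, slicing an edge gives a face of
  the section, and this face is the single crossing point.\<close>

lemma vertices_section:
  fixes P :: "'a::euclidean_space set"
  assumes P: "polytope P"
  shows "vertices (P \<inter> {x. u \<bullet> x = 0}) = {v \<in> vertices P. u \<bullet> v = 0} \<union>
    (\<lambda>(v, w). crossing u v w) ` {(v, w). adjacent P v w \<and> u \<bullet> v < 0 \<and> 0 < u \<bullet> w}"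
    (is "vertices (P \<inter> ?H) = ?A \<union> ?B")
proof
  show "vertices (P \<inter> ?H) \<subseteq> ?A \<union> ?B"
  proof
    fix z assume "z \<in> vertices (P \<inter> ?H)"
    then have z: "z extreme_point_of (P \<inter> ?H)" by (simp add: vertices_def)
    then have z0: "u \<bullet> z = 0" by (simp add: extreme_point_of_def)
    show "z \<in> ?A \<union> ?B"
    proof (cases "z \<in> vertices P")
      case False
      then obtain v w where vw: "adjacent P v w" "u \<bullet> v < 0" "0 < u \<bullet> w" "z \<in> open_segment v w"
        using extreme_point_of_section[OF P z] by metis
      then have "z \<in> closed_segment v w \<inter> ?H" using z0 by (simp add: open_segment_def)
      then have "z = crossing u v w" using closed_segment_Int_hyperplane(1)[OF vw(2,3)] by blast
      then have "z \<in> ?B" using vw by blast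
      then show ?thesis ..
    qed (use z0 in blast)
  qed
  have "crossing u v w \<in> vertices (P \<inter> ?H)" if "adjacent P v w" "u \<bullet> v < 0" "0 < u \<bullet> w" for v w
  proof -
    have "(closed_segment v w \<inter> ?H) face_of (P \<inter> ?H)"
      using that by (intro face_of_slice convex_hyperplane) (simp add: adjacent_def)
    then show ?thesis
      by (simp add: closed_segment_Int_hyperplane(1)[OF that(2,3)] vertices_def face_of_singleton)
  qed
  moreover have "v \<in> vertices (P \<inter> ?H)" if "v \<in> vertices P" "u \<bullet> v = 0" for v
    using that by (auto simp: vertices_def extreme_point_of_def)
  ultimately show "?A \<union> ?B \<subseteq> vertices (P \<inter> ?H)" by auto
qed

text \<open>Two edges with a common relative interior point contain each other as faces. The signs
  of \<open>u\<close> at the ends then fix the order of the pair.\<close>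

lemma inj_on_crossing:
  "inj_on (\<lambda>(v, w). crossing u v w) {(v, w). adjacent P v w \<and> u \<bullet> v < 0 \<and> 0 < u \<bullet> w}"
proof (rule inj_onI; clarify)
  fix v w v' w'
  assume vw: "adjacent P v w" "u \<bullet> v < 0" "0 < u \<bullet> w"
    and vw': "adjacent P v' w'" "u \<bullet> v' < 0" "0 < u \<bullet> w'"
    and eq: "crossing u v w = crossing u v' w'"
  have sub: "closed_segment a b \<subseteq> closed_segment a' b'"
    if ab: "adjacent P a b" "adjacent P a' b'" "z \<in> open_segment a b" "z \<in> open_segment a' b'" for a b a' b' z
  proof (rule subset_of_face_of)
    show "closed_segment a' b' face_of P" using ab by (simp add: adjacent_def)
    show "closed_segment a b \<subseteq> P" using ab by (auto simp: adjacent_def dest: face_of_imp_subset)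
    show "closed_segment a' b' \<inter> rel_interior (closed_segment a b) \<noteq> {}"
      using ab by (auto simp: rel_interior_closed_segment adjacent_def open_segment_def)
  qed
  have "closed_segment v w = closed_segment v' w'"
    using sub[OF vw(1) vw'(1)] sub[OF vw'(1) vw(1)] eq
      closed_segment_Int_hyperplane(2)[OF vw(2,3)] closed_segment_Int_hyperplane(2)[OF vw'(2,3)]
    by (metis subset_antisym)
  then have "{v, w} = {v', w'}" by (simp add: closed_segment_eq)
  then show "v = v' \<and> w = w'" using vw vw' by (auto simp: doubleton_eq_iff)
qed

section \<open>The vertex count as a polynomial in signs\<close>

definition adj_ind :: "'a::euclidean_space set \<Rightarrow> 'a \<Rightarrow> 'a \<Rightarrow> real"
  where "adj_ind P v w = of_bool (adjacent P v w)"

lemma adj_ind_commute: "adj_ind P v w = adj_ind P w v"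
  by (simp add: adj_ind_def adjacent_commute)

lemma adj_ind_self [simp]: "adj_ind P v v = 0"
  by (simp add: adj_ind_def adjacent_def)

text \<open>Four times the vertex count of a section, in terms of the signs \<open>\<sigma>\<close> that the
  normal vector takes on the vertices.\<close>

definition sign_count :: "'a::euclidean_space set \<Rightarrow> ('a \<Rightarrow> real) \<Rightarrow> real"
  where "sign_count P \<sigma> = 4 * (\<Sum>v\<in>vertices P. 1 - (\<sigma> v)\<^sup>2) +
    (\<Sum>v\<in>vertices P. \<Sum>w\<in>vertices P. adj_ind P v w * ((\<sigma> v)\<^sup>2 * (\<sigma> w)\<^sup>2 - \<sigma> v * \<sigma> w))"

lemma sign_count_cong:
  "(\<And>v. v \<in> vertices P \<Longrightarrow> \<sigma> v = \<tau> v) \<Longrightarrow> sign_count P \<sigma> = sign_count P \<tau>"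
  unfolding sign_count_def by (intro arg_cong2[where f = "(+)"] arg_cong2[where f = "(*)"] sum.cong) auto

text \<open>A vertex in the hyperplane has sign 0 and contributes 4. For signs in {-1, 0, 1} the
  edge term is 2 when they are opposite and 0 otherwise, and it occurs for both orders of the ends,
  so a crossing edge contributes 4 too.\<close>

lemma section_vertex_count_signs:
  fixes P :: "'a::euclidean_space set"
  assumes P: "polytope P"
  shows "4 * real (section_vertex_count P u) = sign_count P (\<lambda>x. sgn (u \<bullet> x))"
proof -
  let ?V = "vertices P"
  let ?A = "{v \<in> ?V. u \<bullet> v = 0}"
  let ?E = "{(v, w). adjacent P v w \<and> u \<bullet> v < 0 \<and> 0 < u \<bullet> w}"
  let ?B = "(\<lambda>(v, w). crossing u v w) ` ?E"
  let ?f = "\<lambda>v w. of_bool (adjacent P v w \<and> u \<bullet> v < 0 \<and> 0 < u \<bullet> w) :: real"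
  let ?s = "\<lambda>x. sgn (u \<bullet> x)"
  have fin: "finite ?V" by (rule finite_vertices[OF P])
  have E_sub: "?E \<subseteq> ?V \<times> ?V" using adjacent_vertices by blast
  then have finE: "finite ?E" using fin finite_subset by blast
  have "crossing u v w \<notin> ?V" if "(v, w) \<in> ?E" for v w
  proof
    assume "crossing u v w \<in> ?V"
    moreover have "crossing u v w \<in> open_segment v w"
      using closed_segment_Int_hyperplane(2) that by blast
    moreover have "v \<in> P" "w \<in> P" using that E_sub vertices_subset by blast+
    ultimately show False by (auto simp: vertices_def extreme_point_of_def)
  qed
  then have disj: "?A \<inter> ?B = {}" by auto
  have "{u}\<^sup>\<bottom> = {x. u \<bullet> x = 0}" by (simp add: orthogonal_comp_def orthogonal_def)
  then have "section_vertex_count P u = card (?A \<union> ?B)"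
    by (simp add: section_vertex_count_def num_vertices_def vertices_section[OF P])
  also have "\<dots> = card ?A + card ?B" using fin finE disj by (intro card_Un_disjoint) auto
  also have "card ?B = card ?E" by (rule card_image[OF inj_on_crossing])
  finally have count: "section_vertex_count P u = card ?A + card ?E" .
  have A: "real (card ?A) = (\<Sum>v\<in>?V. 1 - (?s v)\<^sup>2)"
  proof -
    have "(\<Sum>v\<in>?V. 1 - (?s v)\<^sup>2) = (\<Sum>v\<in>?V. if u \<bullet> v = 0 then 1 else 0)"
      by (rule sum.cong) (auto simp: sgn_if)
    also have "\<dots> = real (card ?A)" using fin by (simp add: sum.If_cases Int_def)
    finally show ?thesis ..
  qed
  have E: "real (card ?E) = (\<Sum>v\<in>?V. \<Sum>w\<in>?V. ?f v w)"
  proof -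
    have "(\<Sum>v\<in>?V. \<Sum>w\<in>?V. ?f v w) = (\<Sum>(v, w)\<in>?V \<times> ?V. ?f v w)" by (rule sum.cartesian_product)
    also have "\<dots> = (\<Sum>x\<in>?V \<times> ?V. if x \<in> ?E then 1 else 0)" by (rule sum.cong) auto
    also have "\<dots> = real (card ((?V \<times> ?V) \<inter> ?E))" using fin by (simp add: sum.If_cases Int_def)
    also have "(?V \<times> ?V) \<inter> ?E = ?E" using E_sub by blast
    finally show ?thesis ..
  qed
  \<comment> \<open>Adding the sum with swapped indices removes the orientation from negative to
    positive end.\<close>
  have "2 * real (card ?E) = (\<Sum>v\<in>?V. \<Sum>w\<in>?V. ?f v w) + (\<Sum>w\<in>?V. \<Sum>v\<in>?V. ?f v w)"
    unfolding E by (subst (2) sum.swap) simp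
  also have "\<dots> = (\<Sum>v\<in>?V. \<Sum>w\<in>?V. ?f v w + ?f w v)" by (simp add: sum.distrib)
  also have "\<dots> = (\<Sum>v\<in>?V. \<Sum>w\<in>?V. adj_ind P v w * ((?s v)\<^sup>2 * (?s w)\<^sup>2 - ?s v * ?s w) / 2)"
    by (intro sum.cong refl) (auto simp: adj_ind_def adjacent_commute sgn_if)
  also have "\<dots> = (\<Sum>v\<in>?V. \<Sum>w\<in>?V. adj_ind P v w * ((?s v)\<^sup>2 * (?s w)\<^sup>2 - ?s v * ?s w)) / 2"
    by (simp add: sum_divide_distrib)
  finally show ?thesis unfolding sign_count_def count A[symmetric] by simp
qed

lemma sum_adj_ind_neighbours:
  assumes "polytope P" "v \<in> vertices P"
  shows "(\<Sum>w\<in>vertices P - {v}. adj_ind P v w) = real (card (neighbours P v))"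
proof -
  have "(\<Sum>w\<in>vertices P - {v}. adj_ind P v w) = (\<Sum>w\<in>vertices P - {v}. if w \<in> neighbours P v then 1 else 0)"
    by (rule sum.cong) (auto simp: adj_ind_def neighbours_def)
  also have "\<dots> = real (card ((vertices P - {v}) \<inter> neighbours P v))"
    using finite_vertices[OF assms(1)] by (simp add: sum.If_cases Int_def)
  also have "(vertices P - {v}) \<inter> neighbours P v = neighbours P v"
    using neighbours_subset_vertices[of P v] by (auto simp: neighbours_def adjacent_def)
  finally show ?thesis .
qed

lemma sum_sum_remove:
  fixes f :: "'a \<Rightarrow> 'a \<Rightarrow> real"
  assumes "finite V" "v \<in> V"
  shows "(\<Sum>x\<in>V. \<Sum>y\<in>V. f x y) =
    f v v + (\<Sum>y\<in>V - {v}. f v y + f y v) + (\<Sum>x\<in>V - {v}. \<Sum>y\<in>V - {v}. f x y)"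
proof -
  have "(\<Sum>x\<in>V. \<Sum>y\<in>V. f x y) = (\<Sum>x\<in>V. f x v + (\<Sum>y\<in>V - {v}. f x y))"
    using assms by (intro sum.cong refl) (simp add: sum.remove)
  also have "\<dots> = f v v + (\<Sum>y\<in>V - {v}. f v y) + (\<Sum>x\<in>V - {v}. f x v + (\<Sum>y\<in>V - {v}. f x y))"
    using assms by (simp add: sum.remove)
  finally show ?thesis by (simp add: sum.distrib)
qed

text \<open>The count is quadratic in the sign \<open>s\<close> at \<open>v\<close>. Its second
  difference over -1, 0, 1 is four times the degree of \<open>v\<close> minus 2.\<close>

lemma sign_count_one_vertex:
  fixes P :: "'a::euclidean_space set"
  assumes P: "polytope P" and v: "v \<in> vertices P"
    and \<sigma>: "\<And>x. x \<in> vertices P - {v} \<Longrightarrow> (\<sigma> x)\<^sup>2 = 1"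
  obtains M R where "\<And>s. sign_count P (\<sigma>(v := s)) =
    4 * (1 - s\<^sup>2) + 2 * (s\<^sup>2 * real (card (neighbours P v)) - s * M) + R"
proof -
  let ?V = "vertices P"
  define M where "M = (\<Sum>y\<in>?V - {v}. adj_ind P v y * \<sigma> y)"
  define R where "R = (\<Sum>x\<in>?V - {v}. \<Sum>y\<in>?V - {v}. adj_ind P x y * ((\<sigma> x)\<^sup>2 * (\<sigma> y)\<^sup>2 - \<sigma> x * \<sigma> y))"
  note fin = finite_vertices[OF P]
  have "sign_count P (\<sigma>(v := s)) =
    4 * (1 - s\<^sup>2) + 2 * (s\<^sup>2 * real (card (neighbours P v)) - s * M) + R" for s
  proof -
    let ?\<tau> = "\<sigma>(v := s)"
    let ?g = "\<lambda>x y. adj_ind P x y * ((?\<tau> x)\<^sup>2 * (?\<tau> y)\<^sup>2 - ?\<tau> x * ?\<tau> y)"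
    have "(\<Sum>x\<in>?V. 1 - (?\<tau> x)\<^sup>2) = 1 - s\<^sup>2 + (\<Sum>x\<in>?V - {v}. 1 - (?\<tau> x)\<^sup>2)"
      using fin v by (simp add: sum.remove)
    also have "(\<Sum>x\<in>?V - {v}. 1 - (?\<tau> x)\<^sup>2) = 0" using \<sigma> by (intro sum.neutral) auto
    finally have 1: "(\<Sum>x\<in>?V. 1 - (?\<tau> x)\<^sup>2) = 1 - s\<^sup>2" by simp
    have "(\<Sum>y\<in>?V - {v}. ?g v y + ?g y v) = (\<Sum>y\<in>?V - {v}. 2 * (s\<^sup>2 * adj_ind P v y) - 2 * (s * (adj_ind P v y * \<sigma> y)))"
      using \<sigma> by (intro sum.cong refl) (auto simp: adj_ind_commute[of P _ v] algebra_simps)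
    also have "\<dots> = 2 * (s\<^sup>2 * real (card (neighbours P v)) - s * M)"
      by (simp add: sum_subtractf sum_distrib_left[symmetric] sum_adj_ind_neighbours[OF P v] M_def)
    finally have 2: "(\<Sum>y\<in>?V - {v}. ?g v y + ?g y v) = 2 * (s\<^sup>2 * real (card (neighbours P v)) - s * M)" .
    have 3: "(\<Sum>x\<in>?V - {v}. \<Sum>y\<in>?V - {v}. ?g x y) = R"
      unfolding R_def by (intro sum.cong refl) auto
    show ?thesis unfolding sign_count_def 1 sum_sum_remove[OF fin v, of ?g] 2 3 by simp
  qed
  then show ?thesis using that by blast
qed

text \<open>With all squares equal to 1 the count is affine in each of \<open>s\<close> and
  \<open>t\<close>, and its mixed coefficient reveals whether \<open>v\<close> and \<open>w\<close>
  are adjacent.\<close>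

lemma sign_count_two_vertices:
  fixes P :: "'a::euclidean_space set"
  assumes P: "polytope P" and v: "v \<in> vertices P" and w: "w \<in> vertices P" and vw: "v \<noteq> w"
    and \<sigma>: "\<And>x. x \<in> vertices P - {v, w} \<Longrightarrow> (\<sigma> x)\<^sup>2 = 1"
  obtains M N R where "\<And>s t. s\<^sup>2 = 1 \<Longrightarrow> t\<^sup>2 = 1 \<Longrightarrow> sign_count P (\<sigma>(v := s, w := t)) =
    M * s + N * t - 2 * adj_ind P v w * (s * t) + R"
proof -
  let ?V = "vertices P" and ?U = "vertices P - {v} - {w}"
  note fin = finite_vertices[OF P]
  define M where "M = - 2 * (\<Sum>y\<in>?U. adj_ind P v y * \<sigma> y)"
  define N where "N = - 2 * (\<Sum>y\<in>?U. adj_ind P w y * \<sigma> y)"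
  define R where "R = (\<Sum>y\<in>?U. 2 * adj_ind P v y) + (\<Sum>y\<in>?U. 2 * adj_ind P w y) + 2 * adj_ind P v w
    + (\<Sum>x\<in>?U. \<Sum>y\<in>?U. adj_ind P x y * (1 - \<sigma> x * \<sigma> y))"
  have "sign_count P (\<sigma>(v := s, w := t)) = M * s + N * t - 2 * adj_ind P v w * (s * t) + R"
    if st: "s\<^sup>2 = 1" "t\<^sup>2 = 1" for s t
  proof -
    let ?\<tau> = "\<sigma>(v := s, w := t)"
    let ?g = "\<lambda>x y. adj_ind P x y * (1 - ?\<tau> x * ?\<tau> y)"
    have sq: "(?\<tau> x)\<^sup>2 = 1" if "x \<in> ?V" for x using \<sigma> st that by auto
    have "sign_count P ?\<tau> = (\<Sum>x\<in>?V. \<Sum>y\<in>?V. ?g x y)"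
      unfolding sign_count_def using sq by (simp cong: sum.cong)
    also have "\<dots> = (\<Sum>y\<in>?V - {v}. ?g v y + ?g y v) + (\<Sum>x\<in>?V - {v}. \<Sum>y\<in>?V - {v}. ?g x y)"
      using sum_sum_remove[OF fin v, of ?g] by simp
    also have "(\<Sum>x\<in>?V - {v}. \<Sum>y\<in>?V - {v}. ?g x y) =
        (\<Sum>y\<in>?U. ?g w y + ?g y w) + (\<Sum>x\<in>?U. \<Sum>y\<in>?U. ?g x y)"
      using sum_sum_remove[of "?V - {v}" w ?g] fin w vw by simp
    also have "(\<Sum>y\<in>?V - {v}. ?g v y + ?g y v) = (?g v w + ?g w v) + (\<Sum>y\<in>?U. ?g v y + ?g y v)"
      using fin w vw by (intro sum.remove) auto
    also have "?g v w + ?g w v = 2 * adj_ind P v w - 2 * adj_ind P v w * (s * t)"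
      using vw by (simp add: adj_ind_commute[of P w v] algebra_simps)
    also have "(\<Sum>y\<in>?U. ?g v y + ?g y v) = (\<Sum>y\<in>?U. 2 * adj_ind P v y - 2 * (s * (adj_ind P v y * \<sigma> y)))"
      using vw by (intro sum.cong refl) (auto simp: adj_ind_commute[of P _ v] algebra_simps)
    also have "\<dots> = (\<Sum>y\<in>?U. 2 * adj_ind P v y) + M * s"
      by (simp add: sum_subtractf sum_distrib_left[symmetric] M_def)
    also have "(\<Sum>y\<in>?U. ?g w y + ?g y w) = (\<Sum>y\<in>?U. 2 * adj_ind P w y - 2 * (t * (adj_ind P w y * \<sigma> y)))"
      using vw by (intro sum.cong refl) (auto simp: adj_ind_commute[of P _ w] algebra_simps)
    also have "\<dots> = (\<Sum>y\<in>?U. 2 * adj_ind P w y) + N * t"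
      by (simp add: sum_subtractf sum_distrib_left[symmetric] N_def)
    also have "(\<Sum>x\<in>?U. \<Sum>y\<in>?U. ?g x y) = (\<Sum>x\<in>?U. \<Sum>y\<in>?U. adj_ind P x y * (1 - \<sigma> x * \<sigma> y))"
      by (intro sum.cong refl) auto
    finally show ?thesis unfolding R_def fun_upd_def by linarith
  qed
  then show ?thesis using that by blast
qed

section \<open>Generic and perturbed normal vectors\<close>

text \<open>Continuity preserves the nonzero signs for small positive \<open>t\<close>, and where
  \<open>u\<close> vanishes the sign is that of \<open>r\<close>.\<close>

lemma eventually_sgn_perturbed:
  fixes u r :: "'a::euclidean_space"
  assumes "finite X"
  shows "\<forall>\<^sub>F t in at_right 0. \<forall>x\<in>X. sgn ((u + t *\<^sub>R r) \<bullet> x) = (if u \<bullet> x = 0 then sgn (r \<bullet> x) else sgn (u \<bullet> x))"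
proof (rule eventually_ball_finite[OF assms], rule ballI)
  fix x
  have pos: "\<forall>\<^sub>F t in at_right (0::real). t > 0" by (simp add: eventually_at_right_less)
  have lim: "((\<lambda>t. (u + t *\<^sub>R r) \<bullet> x) \<longlongrightarrow> (u + 0 *\<^sub>R r) \<bullet> x) (at_right 0)"
    by (intro tendsto_intros)
  consider "u \<bullet> x = 0" | "u \<bullet> x > 0" | "u \<bullet> x < 0" by linarith
  then show "\<forall>\<^sub>F t in at_right 0. sgn ((u + t *\<^sub>R r) \<bullet> x) = (if u \<bullet> x = 0 then sgn (r \<bullet> x) else sgn (u \<bullet> x))"
  proof cases
    case 1
    show ?thesis using pos by eventually_elim (simp add: 1 inner_add_left sgn_mult)
  next
    case 2
    then have "\<forall>\<^sub>F t in at_right 0. 0 < (u + t *\<^sub>R r) \<bullet> x" using lim by (intro order_tendstoD(1)[OF lim]) simp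
    then show ?thesis by eventually_elim (use 2 in simp)
  next
    case 3
    then have "\<forall>\<^sub>F t in at_right 0. (u + t *\<^sub>R r) \<bullet> x < 0" using lim by (intro order_tendstoD(2)[OF lim]) simp
    then show ?thesis by eventually_elim (use 3 in simp)
  qed
qed

lemma sgn_perturbed:
  fixes u r :: "'a::euclidean_space"
  assumes "finite X"
  obtains t where "\<And>x. x \<in> X \<Longrightarrow> sgn ((u + t *\<^sub>R r) \<bullet> x) = (if u \<bullet> x = 0 then sgn (r \<bullet> x) else sgn (u \<bullet> x))"
  using eventually_happens[OF eventually_sgn_perturbed[OF assms, of u r]] that by auto

text \<open>Points are treated one at a time: a small perturbation along a functional that vanishes
  on \<open>B\<close> and is positive at the new point keeps all values that are already
  nonzero.\<close>

lemma generic_functional: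
  fixes X :: "'a::euclidean_space set"
  assumes "finite X" "X \<inter> span B = {}"
  obtains u where "\<And>b. b \<in> B \<Longrightarrow> u \<bullet> b = 0" "\<And>x. x \<in> X \<Longrightarrow> u \<bullet> x \<noteq> 0"
proof -
  have "\<exists>u. (\<forall>b\<in>B. u \<bullet> b = 0) \<and> (\<forall>x\<in>X. u \<bullet> x \<noteq> 0)"
    using assms
  proof (induction X rule: finite_induct)
    case empty
    show ?case by (intro exI[of _ 0]) simp
  next
    case (insert x X)
    then obtain u where u: "\<forall>b\<in>B. u \<bullet> b = 0" "\<forall>x\<in>X. u \<bullet> x \<noteq> 0" by auto
    obtain r where r: "\<And>b. b \<in> B \<Longrightarrow> r \<bullet> b = 0" "r \<bullet> x > 0"
      using not_in_span_functional[of x B] insert by auto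
    have "finite (insert x X)" using insert by simp
    then obtain t where t: "\<And>y. y \<in> insert x X \<Longrightarrow>
        sgn ((u + t *\<^sub>R r) \<bullet> y) = (if u \<bullet> y = 0 then sgn (r \<bullet> y) else sgn (u \<bullet> y))"
      using sgn_perturbed[of "insert x X" u r] by blast
    have "(u + t *\<^sub>R r) \<bullet> y \<noteq> 0" if "y \<in> insert x X" for y
      using t[OF that] u(2) r(2) that by (metis insert_iff less_irrefl sgn_zero_iff)
    moreover have "(u + t *\<^sub>R r) \<bullet> b = 0" if "b \<in> B" for b
      using u r that by (simp add: inner_add_left)
    ultimately show ?case by blast
  qed
  then show ?thesis using that by blast
qed

section \<open>Reconstruction\<close>

lemma section_vertex_count_scale:
  assumes "k \<noteq> 0"
  shows "section_vertex_count P (k *\<^sub>R u) = section_vertex_count P u"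
proof -
  have "{k *\<^sub>R u}\<^sup>\<bottom> = {u}\<^sup>\<bottom>" using assms by (simp add: orthogonal_comp_def orthogonal_def)
  then show ?thesis by (simp add: section_vertex_count_def)
qed

text \<open>Perturbed normals are not unit vectors, so the hypothesis is extended by
  scaling.\<close>

lemma section_vertex_count_eq_off_zero:
  assumes "\<forall>u\<in>sphere 0 1. section_vertex_count P u = section_vertex_count Q u" "u \<noteq> 0"
  shows "section_vertex_count P u = section_vertex_count Q u"
proof -
  have "(1 / norm u) *\<^sub>R u \<in> sphere 0 1" using assms by simp
  then have "section_vertex_count P ((1 / norm u) *\<^sub>R u) = section_vertex_count Q ((1 / norm u) *\<^sub>R u)"
    using assms(1) by blast
  then show ?thesis using assms(2) by (simp add: section_vertex_count_scale)
qed

lemma card_vertices_ge: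
  fixes P :: "'a::euclidean_space set"
  assumes P: "polytope P" and full: "aff_dim P = int DIM('a)"
  shows "DIM('a) < card (vertices P)"
proof -
  have "aff_dim (vertices P) = int DIM('a)"
    using full polytope_eq_hull_vertices[OF P] by (metis aff_dim_convex_hull)
  then show ?thesis using aff_dim_le_card[OF finite_vertices[OF P]] by simp
qed

lemma general_position_span2:
  assumes gen: "three_general_linear_position P"
    and V: "{v, w, x} \<subseteq> vertices P" and ne: "v \<noteq> w" "v \<noteq> x" "w \<noteq> x"
  shows "x \<notin> span {v, w}"
proof -
  have "card {x, v, w} = 3" using ne by auto
  then have "independent {x, v, w}"
    using gen V unfolding three_general_linear_position_def by auto
  then show ?thesis using ne by (auto simp: independent_insert)
qed

text \<open>General position speaks of triples only; a third vertex completes the pair.\<close>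

lemma general_position_span1:
  assumes P: "polytope P" and gen: "three_general_linear_position P"
    and c: "3 \<le> card (vertices P)"
    and v: "v \<in> vertices P" and w: "w \<in> vertices P" and ne: "v \<noteq> w"
  shows "w \<notin> span {v}"
proof -
  have "card {v, w} \<le> 2" by (simp add: card_insert_if)
  then have "\<not> vertices P \<subseteq> {v, w}" using c card_mono[of "{v, w}" "vertices P"] by auto
  then obtain x where x: "x \<in> vertices P" "x \<noteq> v" "x \<noteq> w" by blast
  have "w \<notin> span {x, v}" using general_position_span2[OF gen, of x v w] v w x ne by auto
  then show ?thesis using span_mono[of "{v}" "{x, v}"] by blast
qed

lemma zero_not_vertex: "0 \<in> interior P \<Longrightarrow> v \<in> vertices P \<Longrightarrow> v \<noteq> 0"
  using extreme_point_not_in_interior by (auto simp: vertices_def)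

section \<open>Recovering the vertex lines and the edges\<close>

text \<open>If \<open>Q\<close> had no vertex on the line of \<open>v\<close>, a generic
  \<open>u\<close> orthogonal to \<open>v\<close> would vanish at no vertex of \<open>Q\<close> and
  only at \<open>v\<close> in \<open>P\<close>. Tilting \<open>u\<close> slightly towards
  \<open>v\<close> or \<open>- v\<close> leaves the count of \<open>Q\<close> fixed, so the second
  difference of the count of \<open>P\<close> would be 0 and \<open>v\<close> would have degree
  2.\<close>

lemma proportional_vertex_exists:
  fixes P Q :: "'a::euclidean_space set"
  assumes P: "polytope P" and Q: "polytope Q"
    and gen: "three_general_linear_position P" and c3: "3 \<le> card (vertices P)"
    and zero: "0 \<in> interior P" and v: "v \<in> vertices P" and deg: "card (neighbours P v) \<noteq> 2"
    and eq: "\<And>u. u \<noteq> 0 \<Longrightarrow> section_vertex_count P u = section_vertex_count Q u"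
  shows "\<exists>c. c *\<^sub>R v \<in> vertices Q"
proof (rule ccontr)
  assume no: "\<not> ?thesis"
  note finP = finite_vertices[OF P] and finQ = finite_vertices[OF Q]
  let ?X = "(vertices P - {v}) \<union> vertices Q"
  have "y \<notin> span {v}" if "y \<in> ?X" for y
  proof (cases "y \<in> vertices P - {v}")
    case True
    then show ?thesis using general_position_span1[OF P gen c3 v] by blast
  next
    case False
    then show ?thesis using that no by (auto simp: span_singleton)
  qed
  then have "?X \<inter> span {v} = {}" by blast
  moreover have "finite ?X" using finP finQ by simp
  ultimately obtain u where u: "u \<bullet> v = 0" "\<And>x. x \<in> ?X \<Longrightarrow> u \<bullet> x \<noteq> 0"
    using generic_functional[of ?X "{v}"] by (metis singletonI)
  have "v \<noteq> 0" using zero v zero_not_vertex by blast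
  let ?\<sigma> = "\<lambda>x. sgn (u \<bullet> x)"
  have "?\<sigma> x ^ 2 = 1" if "x \<in> vertices P - {v}" for x
    using u(2)[of x] that by (auto simp: sgn_if)
  then obtain M R where MR: "\<And>s. sign_count P (?\<sigma>(v := s)) =
      4 * (1 - s\<^sup>2) + 2 * (s\<^sup>2 * real (card (neighbours P v)) - s * M) + R"
    using sign_count_one_vertex[OF P v] by metis
  have count: "sign_count P (?\<sigma>(v := s)) = sign_count Q ?\<sigma>" if s: "s \<in> {1, -1}" for s
  proof -
    obtain t where t: "\<And>x. x \<in> vertices P \<union> vertices Q \<Longrightarrow> sgn ((u + t *\<^sub>R (s *\<^sub>R v)) \<bullet> x) =
        (if u \<bullet> x = 0 then sgn ((s *\<^sub>R v) \<bullet> x) else sgn (u \<bullet> x))"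
      using sgn_perturbed[of "vertices P \<union> vertices Q" u "s *\<^sub>R v"] finP finQ by blast
    let ?u = "u + t *\<^sub>R (s *\<^sub>R v)"
    have sv: "sgn (?u \<bullet> v) = s" using t[of v] v u s \<open>v \<noteq> 0\<close> by auto
    then have "?u \<noteq> 0" using s by auto
    have "sign_count P (?\<sigma>(v := s)) = sign_count P (\<lambda>x. sgn (?u \<bullet> x))"
      using t u sv by (intro sign_count_cong) auto
    also have "\<dots> = sign_count Q (\<lambda>x. sgn (?u \<bullet> x))"
      using section_vertex_count_signs[OF P] section_vertex_count_signs[OF Q] eq[OF \<open>?u \<noteq> 0\<close>] by metis
    also have "\<dots> = sign_count Q ?\<sigma>" using t u by (intro sign_count_cong) auto
    finally show ?thesis .
  qed
  \<comment> \<open>A second vertex ensures that \<open>u\<close> is nonzero; the counts are known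
    to agree only for nonzero normals.\<close>
  have "\<not> vertices P \<subseteq> {v}" using c3 card_mono[of "{v}" "vertices P"] by auto
  then obtain x where "x \<in> ?X" by blast
  then have "u \<noteq> 0" using u(2)[of x] by auto
  have "sign_count P (?\<sigma>(v := 0)) = sign_count P ?\<sigma>" using u by (intro sign_count_cong) auto
  also have "\<dots> = sign_count Q ?\<sigma>"
    using section_vertex_count_signs[OF P] section_vertex_count_signs[OF Q] eq[OF \<open>u \<noteq> 0\<close>] by metis
  finally have "real (card (neighbours P v)) = 2"
    using MR[of 0] MR[of 1] MR[of "-1"] count[of 1] count[of "-1"] by simp
  then show False using deg by simp
qed

text \<open>For generic \<open>u\<close> orthogonal to \<open>v\<close> and \<open>w\<close>, small
  tilts realise all four sign pairs at these vertices; in \<open>Q\<close> the signs are multiplied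
  by \<open>sgn a\<close> and \<open>sgn b\<close>. Comparing mixed coefficients gives both claims,
  as each adjacency indicator is 0 or 1.\<close>

lemma adjacent_proportional_vertices:
  fixes P Q :: "'a::euclidean_space set"
  assumes P: "polytope P" and Q: "polytope Q"
    and genP: "three_general_linear_position P" and c3: "3 \<le> card (vertices P)"
    and genQ: "three_general_linear_position Q"
    and zero: "0 \<in> interior P" "0 \<in> interior Q"
    and eq: "\<And>u. u \<noteq> 0 \<Longrightarrow> section_vertex_count P u = section_vertex_count Q u"
    and v: "v \<in> vertices P" and w: "w \<in> vertices P" and vw: "v \<noteq> w"
    and v': "a *\<^sub>R v \<in> vertices Q" and w': "b *\<^sub>R w \<in> vertices Q"
  shows "adjacent Q (a *\<^sub>R v) (b *\<^sub>R w) \<longleftrightarrow> adjacent P v w" "adjacent P v w \<Longrightarrow> a * b > 0"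
proof -
  note finP = finite_vertices[OF P] and finQ = finite_vertices[OF Q]
  let ?v' = "a *\<^sub>R v" and ?w' = "b *\<^sub>R w"
  have ab: "a \<noteq> 0" "b \<noteq> 0" using zero_not_vertex[OF zero(2) v'] zero_not_vertex[OF zero(2) w'] by auto
  have wv: "w \<notin> span {v}" and vw': "v \<notin> span {w}"
    using general_position_span1[OF P genP c3] v w vw by auto
  have vw2: "?v' \<noteq> ?w'"
  proof
    assume "?v' = ?w'"
    then have "w = (a / b) *\<^sub>R v" using ab by (metis divide_inverse_commute scaleR_scaleR left_inverse scaleR_one)
    then show False using wv by (auto simp: span_singleton)
  qed
  let ?X = "(vertices P - {v, w}) \<union> (vertices Q - {?v', ?w'})"
  have "y \<notin> span {v, w}" if "y \<in> ?X" for y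
  proof (cases "y \<in> vertices P - {v, w}")
    case True
    then show ?thesis using general_position_span2[OF genP, of v w y] v w vw by auto
  next
    case False
    then have "y \<in> vertices Q - {?v', ?w'}" using that by blast
    then have "y \<notin> span {?v', ?w'}"
      using general_position_span2[OF genQ, of ?v' ?w' y] v' w' vw2 by auto
    \<comment> \<open>The two pairs span the same plane, so general position of \<open>Q\<close>
      excludes its remaining vertices from the span of \<open>v\<close> and
      \<open>w\<close>.\<close>
    moreover have "v = (1 / a) *\<^sub>R ?v'" "w = (1 / b) *\<^sub>R ?w'" using ab by simp_all
    then have "v \<in> span {?v', ?w'}" "w \<in> span {?v', ?w'}" by (metis insertI1 insertI2 span_base span_scale)+
    then have "span {v, w} \<subseteq> span {?v', ?w'}" by (simp add: span_minimal)
    ultimately show ?thesis by blast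
  qed
  then have "?X \<inter> span {v, w} = {}" by blast
  moreover have "finite ?X" using finP finQ by simp
  ultimately obtain u where u: "u \<bullet> v = 0" "u \<bullet> w = 0" "\<And>x. x \<in> ?X \<Longrightarrow> u \<bullet> x \<noteq> 0"
    using generic_functional[of ?X "{v, w}"] by (metis insertI1 insertI2)
  \<comment> \<open>\<open>p\<close> and \<open>q\<close> each see only one of \<open>v\<close> and
    \<open>w\<close>, so that \<open>s *\<^sub>R p + t *\<^sub>R q\<close> prescribes the two signs
    independently.\<close>
  obtain p where p: "p \<bullet> w = 0" "p \<bullet> v > 0" using not_in_span_functional[OF vw'] by auto
  obtain q where q: "q \<bullet> v = 0" "q \<bullet> w > 0" using not_in_span_functional[OF wv] by auto
  let ?\<sigma> = "\<lambda>x. sgn (u \<bullet> x)"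
  have \<sigma>: "?\<sigma> x ^ 2 = 1" if "x \<in> ?X" for x using u(3)[OF that] by (auto simp: sgn_if)
  obtain M N R where MP: "\<And>s t. s\<^sup>2 = 1 \<Longrightarrow> t\<^sup>2 = 1 \<Longrightarrow> sign_count P (?\<sigma>(v := s, w := t)) =
      M * s + N * t - 2 * adj_ind P v w * (s * t) + R"
    using sign_count_two_vertices[OF P v w vw, of ?\<sigma>] \<sigma> by blast
  obtain M' N' R' where MQ: "\<And>s t. s\<^sup>2 = 1 \<Longrightarrow> t\<^sup>2 = 1 \<Longrightarrow> sign_count Q (?\<sigma>(?v' := s, ?w' := t)) =
      M' * s + N' * t - 2 * adj_ind Q ?v' ?w' * (s * t) + R'"
    using sign_count_two_vertices[OF Q v' w' vw2, of ?\<sigma>] \<sigma> by blast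
  have sg: "(sgn a)\<^sup>2 = 1" "(sgn b)\<^sup>2 = 1" using ab by (auto simp: sgn_if)
  have count: "sign_count P (?\<sigma>(v := s, w := t)) = sign_count Q (?\<sigma>(?v' := s * sgn a, ?w' := t * sgn b))"
    if st: "s \<in> {1, -1}" "t \<in> {1, -1}" for s t
  proof -
    let ?r = "s *\<^sub>R p + t *\<^sub>R q"
    obtain e where e: "\<And>x. x \<in> vertices P \<union> vertices Q \<Longrightarrow> sgn ((u + e *\<^sub>R ?r) \<bullet> x) =
        (if u \<bullet> x = 0 then sgn (?r \<bullet> x) else sgn (u \<bullet> x))"
      using sgn_perturbed[of "vertices P \<union> vertices Q" u ?r] finP finQ by blast
    let ?u = "u + e *\<^sub>R ?r"
    have rv: "sgn (?r \<bullet> v) = s" "sgn (?r \<bullet> w) = t"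
      using st p q by (auto simp: inner_add_left sgn_mult)
    have sv: "sgn (?u \<bullet> v) = s" "sgn (?u \<bullet> w) = t"
      using e[of v] e[of w] v w u rv by auto
    then have sv': "sgn (?u \<bullet> ?v') = s * sgn a" "sgn (?u \<bullet> ?w') = t * sgn b"
      by (simp_all add: sgn_mult mult.commute)
    have "?u \<noteq> 0" using sv st by auto
    have "sign_count P (?\<sigma>(v := s, w := t)) = sign_count P (\<lambda>x. sgn (?u \<bullet> x))"
      using e u sv by (intro sign_count_cong) auto
    also have "\<dots> = sign_count Q (\<lambda>x. sgn (?u \<bullet> x))"
      using section_vertex_count_signs[OF P] section_vertex_count_signs[OF Q] eq[OF \<open>?u \<noteq> 0\<close>] by metis
    also have "\<dots> = sign_count Q (?\<sigma>(?v' := s * sgn a, ?w' := t * sgn b))"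
    proof (rule sign_count_cong)
      fix x assume x: "x \<in> vertices Q"
      show "sgn (?u \<bullet> x) = (?\<sigma>(?v' := s * sgn a, ?w' := t * sgn b)) x"
      proof (cases "x \<in> {?v', ?w'}")
        case True
        then show ?thesis using sv' vw2 by (elim insertE) (simp_all only: fun_upd_apply if_True if_False refl, simp_all)
      next
        case False
        then show ?thesis using e[of x] u(3)[of x] x by simp
      qed
    qed
    finally show ?thesis .
  qed
  have eqn: "M * s + N * t - 2 * adj_ind P v w * (s * t) + R =
      M' * (s * sgn a) + N' * (t * sgn b) - 2 * adj_ind Q ?v' ?w' * (s * sgn a * (t * sgn b)) + R'"
    if st: "s \<in> {1, -1}" "t \<in> {1, -1}" for s t
    using count[OF st] MP[of s t] MQ[of "s * sgn a" "t * sgn b"] st sg by (auto simp: power_mult_distrib)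
  \<comment> \<open>Adding the equations with equal signs and subtracting those with opposite signs
    leaves only the mixed coefficients.\<close>
  have "adj_ind P v w = adj_ind Q ?v' ?w' * (sgn a * sgn b)"
    using eqn[of 1 1] eqn[of 1 "-1"] eqn[of "-1" 1] eqn[of "-1" "-1"] by simp
  then have "adj_ind P v w = adj_ind Q ?v' ?w' * sgn (a * b)" by (simp add: sgn_mult)
  moreover have "sgn (a * b) = 1 \<or> sgn (a * b) = -1" using ab by (auto simp: sgn_if)
  ultimately show "adjacent Q ?v' ?w' \<longleftrightarrow> adjacent P v w" "adjacent P v w \<Longrightarrow> a * b > 0"
    by (auto simp: adj_ind_def of_bool_def sgn_if split: if_splits)
qed

section \<open>Dimension at least three\<close>

lemma reconstruction_dim_ge_3:
  fixes P Q :: "'a::euclidean_space set"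
  assumes sP: "simple_polytope P" and sQ: "simple_polytope Q"
    and full: "aff_dim P = int DIM('a)" "aff_dim Q = int DIM('a)"
    and gen: "three_general_linear_position P" "three_general_linear_position Q"
    and zero: "0 \<in> interior P" "0 \<in> interior Q"
    and eq: "\<And>u. u \<noteq> 0 \<Longrightarrow> section_vertex_count P u = section_vertex_count Q u"
    and dim: "3 \<le> DIM('a)"
  shows "combinatorially_equivalent P Q"
proof -
  have P: "polytope P" and Q: "polytope Q" using sP sQ by (auto simp: simple_polytope_def)
  have dP: "card (neighbours P v) = DIM('a)" if "v \<in> vertices P" for v
    using card_neighbours_simple[OF sP that] full by simp
  have dQ: "card (neighbours Q v) = DIM('a)" if "v \<in> vertices Q" for v
    using card_neighbours_simple[OF sQ that] full by simp
  have c3: "3 \<le> card (vertices P)" "3 \<le> card (vertices Q)"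
    using card_vertices_ge[OF P full(1)] card_vertices_ge[OF Q full(2)] dim by auto
  have "\<forall>v\<in>vertices P. \<exists>c. c *\<^sub>R v \<in> vertices Q"
    using proportional_vertex_exists[OF P Q gen(1) c3(1) zero(1) _ _ eq] dP dim by auto
  then obtain c where c: "\<And>v. v \<in> vertices P \<Longrightarrow> c v *\<^sub>R v \<in> vertices Q" by metis
  define \<pi> where "\<pi> = (\<lambda>v. c v *\<^sub>R v)"
  have c0: "c v \<noteq> 0" if "v \<in> vertices P" for v
    using c[OF that] zero_not_vertex[OF zero(2)] by force
  have inj: "inj_on \<pi> (vertices P)"
  proof (rule inj_onI, rule ccontr)
    fix v w assume vw: "v \<in> vertices P" "w \<in> vertices P" "\<pi> v = \<pi> w" "v \<noteq> w"
    have "w = (1 / c w) *\<^sub>R \<pi> w" using c0[OF vw(2)] by (simp add: \<pi>_def)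
    also have "\<dots> = (1 / c w) *\<^sub>R c v *\<^sub>R v" unfolding vw(3)[symmetric] by (simp add: \<pi>_def)
    finally have "w \<in> span {v}" by (metis span_base span_scale singletonI)
    then show False using general_position_span1[OF P gen(1) c3(1) vw(1,2,4)] by simp
  qed
  have img: "\<pi> ` vertices P = vertices Q"
  proof
    show "\<pi> ` vertices P \<subseteq> vertices Q" using c by (auto simp: \<pi>_def)
    show "vertices Q \<subseteq> \<pi> ` vertices P"
    proof
      fix y assume y: "y \<in> vertices Q"
      obtain k where k: "k *\<^sub>R y \<in> vertices P"
        using proportional_vertex_exists[OF Q P gen(2) c3(2) zero(2) y] eq dQ[OF y] dim by auto
      have "\<pi> (k *\<^sub>R y) \<in> span {y}" unfolding \<pi>_def by (simp add: span_base span_scale)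
      \<comment> \<open>Both are vertices of \<open>Q\<close> on the same line through the origin,
        which general position allows only if they coincide.\<close>
      then have "\<pi> (k *\<^sub>R y) = y"
        using general_position_span1[OF Q gen(2) c3(2) y, of "\<pi> (k *\<^sub>R y)"] c[OF k]
        unfolding \<pi>_def by metis
      then show "y \<in> \<pi> ` vertices P" using k by force
    qed
  qed
  have adj: "adjacent Q (c v *\<^sub>R v) (c w *\<^sub>R w) \<longleftrightarrow> adjacent P v w"
    if vw: "v \<in> vertices P" "w \<in> vertices P" for v w
  proof (cases "v = w")
    case False
    then show ?thesis
      using adjacent_proportional_vertices(1)[OF P Q gen(1) c3(1) gen(2) zero eq vw _ c[OF vw(1)] c[OF vw(2)]]
      by blast
  qed (simp add: adjacent_def)
  have pos: "c v * c w > 0" if "adjacent P v w" for v w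
    using adjacent_proportional_vertices(2)[OF P Q gen(1) c3(1) gen(2) zero eq _ _ _ c c that]
      adjacent_vertices[OF that] that by (auto simp: adjacent_def)
  show ?thesis
  proof (rule combinatorially_equivalent_if_facets[OF P Q inj img])
    fix F assume F: "F facet_of P"
    obtain G where "G facet_of Q" "vertices Q \<inter> G = (\<lambda>v. c v *\<^sub>R v) ` (vertices P \<inter> F)"
      by (rule facet_transfer[OF P Q zero(1) full dP dQ inj[unfolded \<pi>_def] img[unfolded \<pi>_def] adj pos F])
    then show "\<exists>G. G facet_of Q \<and> vertices Q \<inter> G = \<pi> ` (vertices P \<inter> F)"
      unfolding \<pi>_def by blast
  next
    fix G assume G: "G facet_of Q"
    define \<rho> where "\<rho> = inv_into (vertices P) \<pi>"
    \<comment> \<open>Reciprocal multipliers present the inverse vertex map as a rescaling too, so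
      \<open>facet_transfer\<close> also applies from \<open>Q\<close> to \<open>P\<close>.\<close>
    define c' where "c' y = 1 / c (\<rho> y)" for y
    have \<rho>V: "\<rho> y \<in> vertices P" "\<pi> (\<rho> y) = y" if "y \<in> vertices Q" for y
      using that unfolding \<rho>_def img[symmetric] by (auto simp: inv_into_into f_inv_into_f)
    have c': "c' y *\<^sub>R y = \<rho> y" if "y \<in> vertices Q" for y
    proof -
      have "c' y *\<^sub>R y = c' y *\<^sub>R \<pi> (\<rho> y)" using \<rho>V(2)[OF that] by simp
      also have "\<dots> = \<rho> y" using c0[OF \<rho>V(1)[OF that]] by (simp add: \<pi>_def c'_def)
      finally show ?thesis .
    qed
    have bij: "bij_betw \<rho> (vertices Q) (vertices P)"
      unfolding \<rho>_def using inj img by (intro bij_betw_inv_into) (simp add: bij_betw_def)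
    have inj': "inj_on (\<lambda>y. c' y *\<^sub>R y) (vertices Q)"
      using bij c' by (simp add: bij_betw_def cong: inj_on_cong)
    have img': "(\<lambda>y. c' y *\<^sub>R y) ` vertices Q = vertices P"
      using bij c' by (simp add: bij_betw_def cong: image_cong)
    have adj': "adjacent P (c' y *\<^sub>R y) (c' z *\<^sub>R z) \<longleftrightarrow> adjacent Q y z"
      if "y \<in> vertices Q" "z \<in> vertices Q" for y z
      using adj[OF \<rho>V(1)[OF that(1)] \<rho>V(1)[OF that(2)]] \<rho>V(2) that c' by (simp add: \<pi>_def)
    have pos': "c' y * c' z > 0" if yz: "adjacent Q y z" for y z
    proof -
      have "adjacent P (\<rho> y) (\<rho> z)" using adj'[OF adjacent_vertices[OF yz]] c' adjacent_vertices[OF yz] yz by simp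
      then show ?thesis using pos by (simp add: c'_def zero_less_mult_iff)
    qed
    obtain F where F: "F facet_of P" "vertices P \<inter> F = (\<lambda>y. c' y *\<^sub>R y) ` (vertices Q \<inter> G)"
      by (rule facet_transfer[OF Q P zero(2) full(2,1) dQ dP inj' img' adj' pos' G])
    have "\<pi> ` (vertices P \<inter> F) = (\<lambda>y. \<pi> (c' y *\<^sub>R y)) ` (vertices Q \<inter> G)"
      unfolding F(2) by (simp add: image_image)
    also have "\<dots> = vertices Q \<inter> G" using c' \<rho>V(2) by (simp cong: image_cong_simp)
    finally show "\<exists>F. F facet_of P \<and> vertices Q \<inter> G = \<pi> ` (vertices P \<inter> F)" using F by metis
  qed
qed

section \<open>Dimension one and the final case distinction\<close>

lemma facet_of_one_dim_iff:
  assumes "polytope P" "aff_dim P = 1"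
  shows "F facet_of P \<longleftrightarrow> (\<exists>v\<in>vertices P. F = {v})"
proof
  assume "F facet_of P"
  then have F: "F face_of P" "aff_dim F = 0" using assms by (auto simp: facet_of_def)
  then obtain v where "F = {v}" by (auto simp: aff_dim_eq_0)
  then show "\<exists>v\<in>vertices P. F = {v}" using F by (auto simp: vertices_def face_of_singleton)
qed (use assms in \<open>auto simp: facet_of_def vertices_def face_of_singleton\<close>)

lemma card_vertices_dim_1:
  assumes "polytope P" "aff_dim P = 1"
  shows "card (vertices P) = 2"
proof -
  obtain a b where ab: "a \<noteq> b" "P = closed_segment a b" by (rule one_dim_polytope_segment[OF assms])
  have "vertices P = {a, b}" unfolding ab(2) vertices_def extreme_point_of_segment by blast
  then show ?thesis using ab(1) by simp
qed

text \<open>The facets are the two singleton vertices, so any bijection of the vertices matches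
  them.\<close>

lemma combinatorially_equivalent_dim_1:
  assumes P: "polytope P" and Q: "polytope Q" and dim: "aff_dim P = 1" "aff_dim Q = 1"
  shows "combinatorially_equivalent P Q"
proof -
  obtain \<pi> where \<pi>: "bij_betw \<pi> (vertices P) (vertices Q)"
    using finite_same_card_bij[OF finite_vertices[OF P] finite_vertices[OF Q]]
      card_vertices_dim_1[OF P dim(1)] card_vertices_dim_1[OF Q dim(2)] by auto
  show ?thesis
  proof (rule combinatorially_equivalent_if_facets[OF P Q])
    show "inj_on \<pi> (vertices P)" "\<pi> ` vertices P = vertices Q" using \<pi> by (auto simp: bij_betw_def)
    then show "\<exists>G. G facet_of Q \<and> vertices Q \<inter> G = \<pi> ` (vertices P \<inter> F)" if "F facet_of P" for F
      using that by (auto simp: facet_of_one_dim_iff P Q dim)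
    show "\<exists>F. F facet_of P \<and> vertices Q \<inter> G = \<pi> ` (vertices P \<inter> F)" if G: "G facet_of Q" for G
    proof -
      obtain y where y: "y \<in> vertices Q" "G = {y}" using G by (auto simp: facet_of_one_dim_iff Q dim)
      have "y \<in> \<pi> ` vertices P" using y(1) \<pi> by (simp add: bij_betw_def)
      then obtain x where "x \<in> vertices P" "\<pi> x = y" by auto
      then show ?thesis using y by (intro exI[of _ "{x}"]) (auto simp: facet_of_one_dim_iff P dim)
    qed
  qed
qed

theorem theorem4p5:
  fixes P Q :: "(real ^ 'd) set"
  assumes "simple_polytope P" and "simple_polytope Q"
    and "aff_dim P = int CARD('d)" and "aff_dim Q = int CARD('d)"
    and "three_general_linear_position P" and "three_general_linear_position Q"
    and "0 \<in> interior P" and "0 \<in> interior Q"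
    and "\<forall>u \<in> sphere 0 1. section_vertex_count P u = section_vertex_count Q u"
  shows "combinatorially_equivalent P Q"
proof -
  have P: "polytope P" and Q: "polytope Q" using assms(1,2) by (auto simp: simple_polytope_def)
  \<comment> \<open>A polygon has at least three vertices, and three vectors in the plane are
    dependent.\<close>
  have "CARD('d) \<noteq> 2"
  proof
    assume d: "CARD('d) = 2"
    then have "3 \<le> card (vertices P)" using card_vertices_ge[OF P] assms(3) by simp
    then obtain T where T: "T \<subseteq> vertices P" "card T = 3" using obtain_subset_with_card_n by metis
    then have "independent T" using assms(5) by (simp add: three_general_linear_position_def)
    then show False using independent_bound[of T] T d by simp
  qed
  moreover have "CARD('d) > 0" by simp
  ultimately consider "CARD('d) = 1" | "3 \<le> CARD('d)" by linarith
  then show ?thesis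
  proof cases
    case 1
    then show ?thesis using combinatorially_equivalent_dim_1[OF P Q] assms(3,4) by simp
  next
    case 2
    show ?thesis
      using assms section_vertex_count_eq_off_zero[OF assms(9)] 2
      by (intro reconstruction_dim_ge_3) auto
  qed
qed

end
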